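(* Let $\mathbb C$ be a semi-abelian category, let $A,G$ be objects of $\mathbb C$, and let $\psi:(A|G)\to A$ be a map which can be extended along $j$ to a map $\xi:T(A)\to A$ with $\xi j=\psi$ and $\xi\eta_A=1_A$ (equivalently, $\psi\,\psi_0=c_2^A(\psi|1_A):((A|G)|A)\to A$; such $\xi$ is unique). Then $\psi$ is an action if and only if the following diagram commutes, i.e. $\xi\,c=\psi\,(\xi|1_G)$: $$\begin{array}{ccc}(TA|G)&\xrightarrow{\;c\;}&TA\\ {\scriptstyle(\xi|1_G)}\downarrow&&\downarrow{\scriptstyle\xi}\\ (A|G)&\xrightarrow{\;\psi\;}&A\end{array}$$ where $c=c^{TA,A+G}\!\upharpoonright_G$ is the restriction to $G$ of the conjugation action of $A+G$ on $TA$.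
   Context: Semi-abelian means pointed, finitely complete, finitely cocomplete, protomodular and Barr exact. For objects $A,G$: $i_A,i_G$ are the injections into $A+G$, $r_G=\langle0,1\rangle:A+G\to G$. $(A|G)$ is the kernel of the canonical map $A+G\to A\times G$, with inclusion $\iota=\iota_{A,G}:(A|G)\to A+G$; for $a:A\to A'$, $g:G\to G'$, $(a|g):(A|G)\to(A'|G')$ is the map with $\iota(a|g)=(a+g)\iota$. $TA=T(A)=\mathrm{Ker}(r_G)$ ($G$ fixed) with inclusion $k:TA\to A+G$; $j:(A|G)\to TA$ is the unique map with $kj=\iota$ and $\eta_A:A\to TA$ the unique map with $k\eta_A=i_A$. $\psi:(A|G)\to A$ is an action of $G$ on $A$ if $q_\psi i_A$ is a monomorphism, where $q_\psi:A+G\to Q_\psi$ is the coequalizer of $\iota$ and $i_A\psi$. For an object $E$, $c_2^E=\nabla_E\,\iota_{E,E}:(E|E)\to E$ with $\nabla_E=\langle1,1\rangle$. $\psi_0:((A|G)|A)\to(A|G)$ is the restriction to $A$ of the conjugation action of $A+G$ on the proper subobject $(A|G)$, i.e. the unique map with $\iota\,\psi_0=c_2^{A+G}(\iota|i_A)$. The map $c:(TA|G)\to TA$ is the unique map with $k\,c=c_2^{A+G}(k|i_G)$. *)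

theory Defs
  imports Main
begin

record ('o, 'm) cat =
  Obj :: "'o set"
  Arr :: "'m set"
  Dom :: "'m \<Rightarrow> 'o"
  Cod :: "'m \<Rightarrow> 'o"
  idt :: "'o \<Rightarrow> 'm"
  Comp :: "'m \<Rightarrow> 'm \<Rightarrow> 'm"  (infixr "\<cdot>\<index>" 70)

definition hom :: "('o, 'm) cat \<Rightarrow> 'o \<Rightarrow> 'o \<Rightarrow> 'm set" where
  "hom C A B = {f \<in> Arr C. Dom C f = A \<and> Cod C f = B}"

locale category =
  fixes C :: "('o, 'm) cat" (structure)
  assumes Dom_Obj: "f \<in> Arr C \<Longrightarrow> Dom C f \<in> Obj C"
    and Cod_Obj: "f \<in> Arr C \<Longrightarrow> Cod C f \<in> Obj C"
    and idt_hom: "A \<in> Obj C \<Longrightarrow> idt C A \<in> hom C A A"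
    and Comp_hom: "f \<in> hom C X Y \<Longrightarrow> g \<in> hom C Y Z \<Longrightarrow> g \<cdot> f \<in> hom C X Z"
    and Comp_idt: "f \<in> hom C X Y \<Longrightarrow> f \<cdot> idt C X = f"
    and idt_Comp: "f \<in> hom C X Y \<Longrightarrow> idt C Y \<cdot> f = f"
    and Comp_assoc: "f \<in> hom C W X \<Longrightarrow> g \<in> hom C X Y \<Longrightarrow> h \<in> hom C Y Z \<Longrightarrow>
      (h \<cdot> g) \<cdot> f = h \<cdot> (g \<cdot> f)"

definition opp :: "('o, 'm) cat \<Rightarrow> ('o, 'm) cat" where
  "opp C = \<lparr>Obj = Obj C, Arr = Arr C, Dom = Cod C, Cod = Dom C, idt = idt C,
            Comp = (\<lambda>g f. f \<cdot>\<^bsub>C\<^esub> g)\<rparr>"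

definition is_functor ::
  "('i, 'n) cat \<Rightarrow> ('o, 'm) cat \<Rightarrow> ('i \<Rightarrow> 'o) \<Rightarrow> ('n \<Rightarrow> 'm) \<Rightarrow> bool" where
  "is_functor J C F0 F1 \<longleftrightarrow>
     (\<forall>x\<in>Obj J. F0 x \<in> Obj C) \<and>
     (\<forall>x y. \<forall>f\<in>hom J x y. F1 f \<in> hom C (F0 x) (F0 y)) \<and>
     (\<forall>x\<in>Obj J. F1 (idt J x) = idt C (F0 x)) \<and>
     (\<forall>x y z. \<forall>f\<in>hom J x y. \<forall>g\<in>hom J y z. F1 (g \<cdot>\<^bsub>J\<^esub> f) = F1 g \<cdot>\<^bsub>C\<^esub> F1 f)"

definition is_mono :: "('o, 'm) cat \<Rightarrow> 'm \<Rightarrow> bool" where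
  "is_mono C f \<longleftrightarrow> f \<in> Arr C \<and>
     (\<forall>X. \<forall>g\<in>hom C X (Dom C f). \<forall>h\<in>hom C X (Dom C f). f \<cdot>\<^bsub>C\<^esub> g = f \<cdot>\<^bsub>C\<^esub> h \<longrightarrow> g = h)"

definition is_iso :: "('o, 'm) cat \<Rightarrow> 'm \<Rightarrow> bool" where
  "is_iso C f \<longleftrightarrow> f \<in> Arr C \<and>
     (\<exists>g\<in>hom C (Cod C f) (Dom C f). g \<cdot>\<^bsub>C\<^esub> f = idt C (Dom C f) \<and> f \<cdot>\<^bsub>C\<^esub> g = idt C (Cod C f))"

definition is_cone ::
  "('i, 'n) cat \<Rightarrow> ('o, 'm) cat \<Rightarrow> ('i \<Rightarrow> 'o) \<Rightarrow> ('n \<Rightarrow> 'm) \<Rightarrow> 'o \<Rightarrow> ('i \<Rightarrow> 'm) \<Rightarrow> bool" where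
  "is_cone J C F0 F1 X p \<longleftrightarrow> X \<in> Obj C \<and>
     (\<forall>x\<in>Obj J. p x \<in> hom C X (F0 x)) \<and>
     (\<forall>x y. \<forall>f\<in>hom J x y. F1 f \<cdot>\<^bsub>C\<^esub> p x = p y)"

definition is_limit ::
  "('i, 'n) cat \<Rightarrow> ('o, 'm) cat \<Rightarrow> ('i \<Rightarrow> 'o) \<Rightarrow> ('n \<Rightarrow> 'm) \<Rightarrow> 'o \<Rightarrow> ('i \<Rightarrow> 'm) \<Rightarrow> bool" where
  "is_limit J C F0 F1 L p \<longleftrightarrow> is_cone J C F0 F1 L p \<and>
     (\<forall>X q. is_cone J C F0 F1 X q \<longrightarrow>
        (\<exists>!h. h \<in> hom C X L \<and> (\<forall>x\<in>Obj J. p x \<cdot>\<^bsub>C\<^esub> h = q x)))"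

text \<open>Every finite category is isomorphic to one whose objects and arrows are natural numbers,
  so it is enough to let the index category range over those.\<close>

definition finitely_complete :: "('o, 'm) cat \<Rightarrow> bool" where
  "finitely_complete C \<longleftrightarrow>
     (\<forall>(J :: (nat, nat) cat) F0 F1.
        category J \<and> finite (Obj J) \<and> finite (Arr J) \<and> is_functor J C F0 F1 \<longrightarrow>
        (\<exists>L p. is_limit J C F0 F1 L p))"

definition finitely_cocomplete :: "('o, 'm) cat \<Rightarrow> bool" where
  "finitely_cocomplete C \<longleftrightarrow> finitely_complete (opp C)"

definition is_initial :: "('o, 'm) cat \<Rightarrow> 'o \<Rightarrow> bool" where
  "is_initial C Z \<longleftrightarrow> Z \<in> Obj C \<and> (\<forall>X\<in>Obj C. \<exists>!f. f \<in> hom C Z X)"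

definition is_terminal :: "('o, 'm) cat \<Rightarrow> 'o \<Rightarrow> bool" where
  "is_terminal C Z \<longleftrightarrow> Z \<in> Obj C \<and> (\<forall>X\<in>Obj C. \<exists>!f. f \<in> hom C X Z)"

definition is_zero :: "('o, 'm) cat \<Rightarrow> 'o \<Rightarrow> bool" where
  "is_zero C Z \<longleftrightarrow> is_initial C Z \<and> is_terminal C Z"

definition pointed :: "('o, 'm) cat \<Rightarrow> bool" where
  "pointed C \<longleftrightarrow> (\<exists>Z. is_zero C Z)"

definition is_product ::
  "('o, 'm) cat \<Rightarrow> 'o \<Rightarrow> 'o \<Rightarrow> 'o \<Rightarrow> 'm \<Rightarrow> 'm \<Rightarrow> bool" where
  "is_product C A B P p q \<longleftrightarrow> p \<in> hom C P A \<and> q \<in> hom C P B \<and>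
     (\<forall>X. \<forall>f\<in>hom C X A. \<forall>g\<in>hom C X B.
        \<exists>!h. h \<in> hom C X P \<and> p \<cdot>\<^bsub>C\<^esub> h = f \<and> q \<cdot>\<^bsub>C\<^esub> h = g)"

definition is_coproduct ::
  "('o, 'm) cat \<Rightarrow> 'o \<Rightarrow> 'o \<Rightarrow> 'o \<Rightarrow> 'm \<Rightarrow> 'm \<Rightarrow> bool" where
  "is_coproduct C A B S i j \<longleftrightarrow> i \<in> hom C A S \<and> j \<in> hom C B S \<and>
     (\<forall>X. \<forall>f\<in>hom C A X. \<forall>g\<in>hom C B X.
        \<exists>!h. h \<in> hom C S X \<and> h \<cdot>\<^bsub>C\<^esub> i = f \<and> h \<cdot>\<^bsub>C\<^esub> j = g)"

definition is_coequalizer :: "('o, 'm) cat \<Rightarrow> 'm \<Rightarrow> 'm \<Rightarrow> 'm \<Rightarrow> bool" where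
  "is_coequalizer C f g q \<longleftrightarrow>
     (\<exists>X Y Q. f \<in> hom C X Y \<and> g \<in> hom C X Y \<and> q \<in> hom C Y Q \<and> q \<cdot>\<^bsub>C\<^esub> f = q \<cdot>\<^bsub>C\<^esub> g \<and>
        (\<forall>Z. \<forall>u\<in>hom C Y Z. u \<cdot>\<^bsub>C\<^esub> f = u \<cdot>\<^bsub>C\<^esub> g \<longrightarrow>
           (\<exists>!v. v \<in> hom C Q Z \<and> v \<cdot>\<^bsub>C\<^esub> q = u)))"

text \<open>\<open>p : P \<rightarrow> A\<close> and \<open>q : P \<rightarrow> B\<close> form a pullback of \<open>f : A \<rightarrow> X\<close> and \<open>g : B \<rightarrow> X\<close>;
  in particular \<open>q\<close> is the pullback of \<open>f\<close> along \<open>g\<close>.\<close>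

definition is_pullback :: "('o, 'm) cat \<Rightarrow> 'm \<Rightarrow> 'm \<Rightarrow> 'm \<Rightarrow> 'm \<Rightarrow> bool" where
  "is_pullback C f g p q \<longleftrightarrow>
     (\<exists>A B X P. f \<in> hom C A X \<and> g \<in> hom C B X \<and> p \<in> hom C P A \<and> q \<in> hom C P B \<and>
        f \<cdot>\<^bsub>C\<^esub> p = g \<cdot>\<^bsub>C\<^esub> q \<and>
        (\<forall>Z. \<forall>u\<in>hom C Z A. \<forall>v\<in>hom C Z B. f \<cdot>\<^bsub>C\<^esub> u = g \<cdot>\<^bsub>C\<^esub> v \<longrightarrow>
           (\<exists>!h. h \<in> hom C Z P \<and> p \<cdot>\<^bsub>C\<^esub> h = u \<and> q \<cdot>\<^bsub>C\<^esub> h = v)))"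

text \<open>A point over \<open>Y\<close> is a split epimorphism \<open>p : E \<rightarrow> Y\<close> with a chosen section \<open>s\<close>.
  Protomodularity says that for each \<open>v : X \<rightarrow> Y\<close> the pullback functor from points over \<open>Y\<close> to
  points over \<open>X\<close> reflects isomorphisms.  Below, \<open>f\<close> is a morphism of points over \<open>Y\<close>,
  and \<open>g\<close> is its image under that functor.\<close>

definition is_point :: "('o, 'm) cat \<Rightarrow> 'o \<Rightarrow> 'o \<Rightarrow> 'm \<Rightarrow> 'm \<Rightarrow> bool" where
  "is_point C E Y p s \<longleftrightarrow> p \<in> hom C E Y \<and> s \<in> hom C Y E \<and> p \<cdot>\<^bsub>C\<^esub> s = idt C Y"

definition protomodular :: "('o, 'm) cat \<Rightarrow> bool" where
  "protomodular C \<longleftrightarrow>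
     (\<forall>X Y v E p s E' p' s' f P a b P' a' b' g.
        v \<in> hom C X Y \<and>
        is_point C E Y p s \<and> is_point C E' Y p' s' \<and>
        f \<in> hom C E E' \<and> p' \<cdot>\<^bsub>C\<^esub> f = p \<and> f \<cdot>\<^bsub>C\<^esub> s = s' \<and>
        a \<in> hom C P E \<and> b \<in> hom C P X \<and> is_pullback C p v a b \<and>
        a' \<in> hom C P' E' \<and> b' \<in> hom C P' X \<and> is_pullback C p' v a' b' \<and>
        g \<in> hom C P P' \<and> a' \<cdot>\<^bsub>C\<^esub> g = f \<cdot>\<^bsub>C\<^esub> a \<and> b' \<cdot>\<^bsub>C\<^esub> g = b \<and>
        is_iso C g
        \<longrightarrow> is_iso C f)"

definition is_regular_epi :: "('o, 'm) cat \<Rightarrow> 'm \<Rightarrow> bool" where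
  "is_regular_epi C q \<longleftrightarrow> (\<exists>f g. is_coequalizer C f g q)"

definition is_kernel_pair :: "('o, 'm) cat \<Rightarrow> 'm \<Rightarrow> 'm \<Rightarrow> 'm \<Rightarrow> bool" where
  "is_kernel_pair C f p q \<longleftrightarrow> is_pullback C f f p q"

definition regular_category :: "('o, 'm) cat \<Rightarrow> bool" where
  "regular_category C \<longleftrightarrow> finitely_complete C \<and>
     (\<forall>f p q. is_kernel_pair C f p q \<longrightarrow> (\<exists>e. is_coequalizer C p q e)) \<and>
     (\<forall>f g p q. is_regular_epi C f \<and> is_pullback C f g p q \<longrightarrow> is_regular_epi C q)"

definition is_equivalence_relation ::
  "('o, 'm) cat \<Rightarrow> 'o \<Rightarrow> 'o \<Rightarrow> 'm \<Rightarrow> 'm \<Rightarrow> bool" where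
  "is_equivalence_relation C R X r1 r2 \<longleftrightarrow>
     r1 \<in> hom C R X \<and> r2 \<in> hom C R X \<and>
     (\<forall>Z. \<forall>u\<in>hom C Z R. \<forall>v\<in>hom C Z R.
        r1 \<cdot>\<^bsub>C\<^esub> u = r1 \<cdot>\<^bsub>C\<^esub> v \<and> r2 \<cdot>\<^bsub>C\<^esub> u = r2 \<cdot>\<^bsub>C\<^esub> v \<longrightarrow> u = v) \<and>
     (\<exists>d\<in>hom C X R. r1 \<cdot>\<^bsub>C\<^esub> d = idt C X \<and> r2 \<cdot>\<^bsub>C\<^esub> d = idt C X) \<and>
     (\<exists>s\<in>hom C R R. r1 \<cdot>\<^bsub>C\<^esub> s = r2 \<and> r2 \<cdot>\<^bsub>C\<^esub> s = r1) \<and>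
     (\<forall>P p1 p2. p1 \<in> hom C P R \<and> p2 \<in> hom C P R \<and> is_pullback C r2 r1 p1 p2 \<longrightarrow>
        (\<exists>t\<in>hom C P R. r1 \<cdot>\<^bsub>C\<^esub> t = r1 \<cdot>\<^bsub>C\<^esub> p1 \<and> r2 \<cdot>\<^bsub>C\<^esub> t = r2 \<cdot>\<^bsub>C\<^esub> p2))"

definition Barr_exact :: "('o, 'm) cat \<Rightarrow> bool" where
  "Barr_exact C \<longleftrightarrow> regular_category C \<and>
     (\<forall>R X r1 r2. is_equivalence_relation C R X r1 r2 \<longrightarrow> (\<exists>f. is_kernel_pair C f r1 r2))"

locale semi_abelian = category +
  assumes pointed: "pointed C"
    and finitely_complete: "finitely_complete C"
    and finitely_cocomplete: "finitely_cocomplete C"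
    and protomodular: "protomodular C"
    and Barr_exact: "Barr_exact C"

text \<open>Limits and colimits are selected by \<open>SOME\<close>, an arbitrary but fixed choice; induced arrows
  are the unique ones given by the universal property.  All of these are meaningful only in a
  category where the (co)limits in question exist.\<close>

definition zero_arr :: "('o, 'm) cat \<Rightarrow> 'o \<Rightarrow> 'o \<Rightarrow> 'm" where
  "zero_arr C A B =
     (THE f. \<exists>Z. is_zero C Z \<and> (\<exists>u\<in>hom C A Z. \<exists>v\<in>hom C Z B. f = v \<cdot>\<^bsub>C\<^esub> u))"

definition product :: "('o, 'm) cat \<Rightarrow> 'o \<Rightarrow> 'o \<Rightarrow> 'o \<times> 'm \<times> 'm" where
  "product C A B = (SOME (P, p, q). is_product C A B P p q)"

definition prod_obj :: "('o, 'm) cat \<Rightarrow> 'o \<Rightarrow> 'o \<Rightarrow> 'o" where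
  "prod_obj C A B = fst (product C A B)"

definition proj1 :: "('o, 'm) cat \<Rightarrow> 'o \<Rightarrow> 'o \<Rightarrow> 'm" where
  "proj1 C A B = fst (snd (product C A B))"

definition proj2 :: "('o, 'm) cat \<Rightarrow> 'o \<Rightarrow> 'o \<Rightarrow> 'm" where
  "proj2 C A B = snd (snd (product C A B))"

definition pairing :: "('o, 'm) cat \<Rightarrow> 'm \<Rightarrow> 'm \<Rightarrow> 'm" where
  "pairing C f g =
     (THE h. h \<in> hom C (Dom C f) (prod_obj C (Cod C f) (Cod C g)) \<and>
        proj1 C (Cod C f) (Cod C g) \<cdot>\<^bsub>C\<^esub> h = f \<and> proj2 C (Cod C f) (Cod C g) \<cdot>\<^bsub>C\<^esub> h = g)"

definition coproduct :: "('o, 'm) cat \<Rightarrow> 'o \<Rightarrow> 'o \<Rightarrow> 'o \<times> 'm \<times> 'm" where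
  "coproduct C A B = (SOME (S, i, j). is_coproduct C A B S i j)"

definition coprod_obj :: "('o, 'm) cat \<Rightarrow> 'o \<Rightarrow> 'o \<Rightarrow> 'o" where
  "coprod_obj C A B = fst (coproduct C A B)"

definition inj1 :: "('o, 'm) cat \<Rightarrow> 'o \<Rightarrow> 'o \<Rightarrow> 'm" where
  "inj1 C A B = fst (snd (coproduct C A B))"

definition inj2 :: "('o, 'm) cat \<Rightarrow> 'o \<Rightarrow> 'o \<Rightarrow> 'm" where
  "inj2 C A B = snd (snd (coproduct C A B))"

definition copairing :: "('o, 'm) cat \<Rightarrow> 'm \<Rightarrow> 'm \<Rightarrow> 'm" where
  "copairing C f g =
     (THE h. h \<in> hom C (coprod_obj C (Dom C f) (Dom C g)) (Cod C f) \<and>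
        h \<cdot>\<^bsub>C\<^esub> inj1 C (Dom C f) (Dom C g) = f \<and> h \<cdot>\<^bsub>C\<^esub> inj2 C (Dom C f) (Dom C g) = g)"

definition coprod_map :: "('o, 'm) cat \<Rightarrow> 'm \<Rightarrow> 'm \<Rightarrow> 'm" where
  "coprod_map C f g =
     copairing C (inj1 C (Cod C f) (Cod C g) \<cdot>\<^bsub>C\<^esub> f) (inj2 C (Cod C f) (Cod C g) \<cdot>\<^bsub>C\<^esub> g)"

definition is_kernel :: "('o, 'm) cat \<Rightarrow> 'm \<Rightarrow> 'm \<Rightarrow> bool" where
  "is_kernel C f k \<longleftrightarrow>
     (\<exists>K X Y. f \<in> hom C X Y \<and> k \<in> hom C K X \<and> f \<cdot>\<^bsub>C\<^esub> k = zero_arr C K Y \<and>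
        (\<forall>Z. \<forall>u\<in>hom C Z X. f \<cdot>\<^bsub>C\<^esub> u = zero_arr C Z Y \<longrightarrow>
           (\<exists>!h. h \<in> hom C Z K \<and> k \<cdot>\<^bsub>C\<^esub> h = u)))"

definition kernel :: "('o, 'm) cat \<Rightarrow> 'm \<Rightarrow> 'm" where
  "kernel C f = (SOME k. is_kernel C f k)"

definition coequalizer :: "('o, 'm) cat \<Rightarrow> 'm \<Rightarrow> 'm \<Rightarrow> 'm" where
  "coequalizer C f g = (SOME q. is_coequalizer C f g q)"

definition sum_to_prod :: "('o, 'm) cat \<Rightarrow> 'o \<Rightarrow> 'o \<Rightarrow> 'm" where
  "sum_to_prod C A G =
     copairing C (pairing C (idt C A) (zero_arr C A G)) (pairing C (zero_arr C G A) (idt C G))"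

text \<open>\<open>iota C A G : (A|G) \<rightarrow> A + G\<close>, with \<open>(A|G) = cosmash C A G\<close>.\<close>

definition iota :: "('o, 'm) cat \<Rightarrow> 'o \<Rightarrow> 'o \<Rightarrow> 'm" where
  "iota C A G = kernel C (sum_to_prod C A G)"

definition cosmash :: "('o, 'm) cat \<Rightarrow> 'o \<Rightarrow> 'o \<Rightarrow> 'o" where
  "cosmash C A G = Dom C (iota C A G)"

definition cosmash_map :: "('o, 'm) cat \<Rightarrow> 'm \<Rightarrow> 'm \<Rightarrow> 'm" where
  "cosmash_map C a g =
     (THE h. h \<in> hom C (cosmash C (Dom C a) (Dom C g)) (cosmash C (Cod C a) (Cod C g)) \<and>
        iota C (Cod C a) (Cod C g) \<cdot>\<^bsub>C\<^esub> h = coprod_map C a g \<cdot>\<^bsub>C\<^esub> iota C (Dom C a) (Dom C g))"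

definition r_arr :: "('o, 'm) cat \<Rightarrow> 'o \<Rightarrow> 'o \<Rightarrow> 'm" where
  "r_arr C A G = copairing C (zero_arr C A G) (idt C G)"

definition k_arr :: "('o, 'm) cat \<Rightarrow> 'o \<Rightarrow> 'o \<Rightarrow> 'm" where
  "k_arr C A G = kernel C (r_arr C A G)"

definition T_obj :: "('o, 'm) cat \<Rightarrow> 'o \<Rightarrow> 'o \<Rightarrow> 'o" where
  "T_obj C A G = Dom C (k_arr C A G)"

definition j_arr :: "('o, 'm) cat \<Rightarrow> 'o \<Rightarrow> 'o \<Rightarrow> 'm" where
  "j_arr C A G =
     (THE h. h \<in> hom C (cosmash C A G) (T_obj C A G) \<and> k_arr C A G \<cdot>\<^bsub>C\<^esub> h = iota C A G)"

definition eta :: "('o, 'm) cat \<Rightarrow> 'o \<Rightarrow> 'o \<Rightarrow> 'm" where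
  "eta C A G = (THE h. h \<in> hom C A (T_obj C A G) \<and> k_arr C A G \<cdot>\<^bsub>C\<^esub> h = inj1 C A G)"

definition c2 :: "('o, 'm) cat \<Rightarrow> 'o \<Rightarrow> 'm" where
  "c2 C E = copairing C (idt C E) (idt C E) \<cdot>\<^bsub>C\<^esub> iota C E E"

definition psi0 :: "('o, 'm) cat \<Rightarrow> 'o \<Rightarrow> 'o \<Rightarrow> 'm" where
  "psi0 C A G =
     (THE h. h \<in> hom C (cosmash C (cosmash C A G) A) (cosmash C A G) \<and>
        iota C A G \<cdot>\<^bsub>C\<^esub> h =
          c2 C (coprod_obj C A G) \<cdot>\<^bsub>C\<^esub> cosmash_map C (iota C A G) (inj1 C A G))"

definition conj_T :: "('o, 'm) cat \<Rightarrow> 'o \<Rightarrow> 'o \<Rightarrow> 'm" where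
  "conj_T C A G =
     (THE h. h \<in> hom C (cosmash C (T_obj C A G) G) (T_obj C A G) \<and>
        k_arr C A G \<cdot>\<^bsub>C\<^esub> h =
          c2 C (coprod_obj C A G) \<cdot>\<^bsub>C\<^esub> cosmash_map C (k_arr C A G) (inj2 C A G))"

definition is_action :: "('o, 'm) cat \<Rightarrow> 'o \<Rightarrow> 'o \<Rightarrow> 'm \<Rightarrow> bool" where
  "is_action C A G \<psi> \<longleftrightarrow> \<psi> \<in> hom C (cosmash C A G) A \<and>
     is_mono C (coequalizer C (iota C A G) (inj1 C A G \<cdot>\<^bsub>C\<^esub> \<psi>) \<cdot>\<^bsub>C\<^esub> inj1 C A G)"

definition is_extension :: "('o, 'm) cat \<Rightarrow> 'o \<Rightarrow> 'o \<Rightarrow> 'm \<Rightarrow> 'm \<Rightarrow> bool" where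
  "is_extension C A G \<psi> \<xi> \<longleftrightarrow> \<xi> \<in> hom C (T_obj C A G) A \<and>
     \<xi> \<cdot>\<^bsub>C\<^esub> j_arr C A G = \<psi> \<and> \<xi> \<cdot>\<^bsub>C\<^esub> eta C A G = idt C A"

end

theory Submission
  imports Defs
begin

text \<open>The object \<open>TA\<close> is a point over \<open>A\<close> with section \<open>\<eta>\<close> and kernel \<open>j\<close>, hence the semidirect
  product of \<open>(A|G)\<close> and \<open>A\<close>: maps out of it are determined by their restrictions along \<open>j\<close> and
  \<open>\<eta>\<close>, and a pair of restrictions extends exactly when it respects the conjugation action \<open>\<psi>\<^sub>0\<close>.
  In particular \<open>q k = q i\<^sub>A \<xi>\<close>; if \<open>q i\<^sub>A\<close> is monic, it can be cancelled from the diagram composed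
  with it. Conversely the diagram says that \<open>\<xi>\<close> is an algebra for the monad \<open>T\<close>, and in a Barr exact
  protomodular category the reflexive graph \<open>TA + G \<rightrightarrows> A + G\<close> given by the algebra has a
  kernel pair as its image, which relates no two distinct elements of \<open>A\<close>.\<close>

section \<open>Finite limits and colimits\<close>

text \<open>The square and the associativity law agree because \<open>T(TA)\<close> is itself a
  point, over \<open>TA\<close>, with kernel \<open>(TA|G)\<close>. The legs \<open>[k, i_G]\<close>
  and \<open>\<xi> + 1\<close> commute with the retractions to \<open>G\<close>, and restricted to
  the kernels of these they are the multiplication \<mu> and \<open>T(\<xi>)\<close>. Along the
  section, \<open>\<xi> \<mu>\<close> and \<open>\<xi> T(\<xi>)\<close> both give \<xi>; along the
  kernel they give the two sides of the square.

  The obstacle in the converse is that a coequalizer \<open>q\<close> is known by what it must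
  identify, while monicity of \<open>q i_A\<close> bounds what it may identify. Hence the passage to
  a map \<open>f\<close> whose kernel pair is the image of the graph: \<open>f\<close> factors
  through \<open>q\<close>, so it identifies everything that \<open>q\<close> does, and its
  identifications are explicit. They are witnessed in \<open>TA + G\<close> only after pulling back
  along a regular epimorphism. Arrows into an object therefore play the part of elements, a preimage
  is taken on a cover, and the cover is cancelled at the end.\<close>

context category
begin

section \<open>Calculus of arrows and the opposite category\<close>

lemma in_hom: "f \<in> hom C A B \<longleftrightarrow> f \<in> Arr C \<and> Dom C f = A \<and> Cod C f = B"
  by (auto simp: hom_def)

lemma Comp_simps [simp]:
  assumes "f \<in> Arr C" "g \<in> Arr C" "Cod C f = Dom C g"
  shows "g \<cdot> f \<in> Arr C" "Dom C (g \<cdot> f) = Dom C f" "Cod C (g \<cdot> f) = Cod C g"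
  using Comp_hom[of f "Dom C f" "Cod C f" g "Cod C g"] assms by (auto simp: in_hom)

lemma assoc [simp]:
  assumes "f \<in> Arr C" "g \<in> Arr C" "h \<in> Arr C" "Cod C f = Dom C g" "Cod C g = Dom C h"
  shows "(h \<cdot> g) \<cdot> f = h \<cdot> (g \<cdot> f)"
  using Comp_assoc[of f "Dom C f" "Cod C f" g "Cod C g" h "Cod C h"] assms by (auto simp: in_hom)

lemma idt_simps [simp]:
  assumes "A \<in> Obj C"
  shows "idt C A \<in> Arr C" "Dom C (idt C A) = A" "Cod C (idt C A) = A"
  using idt_hom[OF assms] by (auto simp: in_hom)

lemma unit_simps [simp]:
  assumes "f \<in> Arr C"
  shows "Cod C f = A \<Longrightarrow> idt C A \<cdot> f = f" "Dom C f = A \<Longrightarrow> f \<cdot> idt C A = f"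
  using Comp_idt[of f "Dom C f" "Cod C f"] idt_Comp[of f "Dom C f" "Cod C f"] assms
  by (auto simp: in_hom)

lemmas [simp] = Dom_Obj Cod_Obj

text \<open>Simplification brackets composites to the right, so a known equation for
  \<open>g \<cdot> f\<close> no longer matches inside a longer composite. This form makes it
  applicable there.\<close>

lemma reassoc:
  assumes "g \<cdot> f = h" "f \<in> Arr C" "g \<in> Arr C" "Cod C f = Dom C g"
    "x \<in> Arr C" "Cod C x = Dom C f"
  shows "g \<cdot> (f \<cdot> x) = h \<cdot> x"
  using assms by (metis assoc)

lemma monoI:
  assumes "f \<in> Arr C"
    and "\<And>g h. \<lbrakk>g \<in> Arr C; h \<in> Arr C; Dom C g = Dom C h; Cod C g = Dom C f; Cod C h = Dom C f;
      f \<cdot> g = f \<cdot> h\<rbrakk> \<Longrightarrow> g = h"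
  shows "is_mono C f"
  unfolding is_mono_def by (auto simp: in_hom assms(1) intro!: assms(2))

lemma monoD:
  assumes "is_mono C f" "f \<cdot> g = f \<cdot> h" "g \<in> Arr C" "h \<in> Arr C" "Dom C g = Dom C h"
    "Cod C g = Dom C f" "Cod C h = Dom C f"
  shows "g = h"
  using assms by (auto simp: is_mono_def in_hom)

lemma mono_right_factor:
  assumes "is_mono C (g \<cdot> f)" "f \<in> Arr C" "g \<in> Arr C" "Cod C f = Dom C g"
  shows "is_mono C f"
proof (rule monoI)
  fix u v
  assume uv: "u \<in> Arr C" "v \<in> Arr C" "Dom C u = Dom C v" "Cod C u = Dom C f" "Cod C v = Dom C f"
    "f \<cdot> u = f \<cdot> v"
  show "u = v"
    by (rule monoD[OF assms(1)]) (use uv assms(2-4) in simp_all)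
qed (use assms in simp)

lemma category_opp: "category (opp C)"
  using Dom_Obj Cod_Obj by unfold_locales (simp_all add: opp_def hom_def)

lemma hom_opp: "hom (opp C) A B = hom C B A"
  by (auto simp: opp_def hom_def)

lemma Comp_opp: "g \<cdot>\<^bsub>opp C\<^esub> f = f \<cdot> g"
  by (simp add: opp_def)

end

text \<open>Two objects 0 and 1, with \<open>n\<close> parallel arrows \<open>0 \<rightarrow> 1\<close> numbered from 2.\<close>

definition pair_shape :: "nat \<Rightarrow> (nat, nat) cat" where
  "pair_shape n = \<lparr>Obj = {0, 1}, Arr = {..<n + 2}, Dom = (\<lambda>m. if m = 1 then 1 else 0),
     Cod = (\<lambda>m. if m = 0 then 0 else 1), idt = (\<lambda>x. x), Comp = (\<lambda>g f. if f \<le> 1 then g else f)\<rparr>"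

lemma pair_shape_simps:
  "Obj (pair_shape n) = {0, 1}" "Arr (pair_shape n) = {..<n + 2}"
  "idt (pair_shape n) x = x" "g \<cdot>\<^bsub>pair_shape n\<^esub> f = (if f \<le> 1 then g else f)"
  by (simp_all add: pair_shape_def)

lemma hom_pair_shape:
  "f \<in> hom (pair_shape n) x y \<longleftrightarrow>
     f = 0 \<and> x = 0 \<and> y = 0 \<or> f = 1 \<and> x = 1 \<and> y = 1 \<or> 2 \<le> f \<and> f < n + 2 \<and> x = 0 \<and> y = 1"
  by (cases "f = 0"; cases "f = 1") (auto simp: pair_shape_def hom_def)

lemma category_pair_shape: "category (pair_shape n)"
proof
  fix f assume "f \<in> Arr (pair_shape n)"
  show "Dom (pair_shape n) f \<in> Obj (pair_shape n)" "Cod (pair_shape n) f \<in> Obj (pair_shape n)"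
    by (simp_all add: pair_shape_def)
qed (auto simp: pair_shape_simps hom_pair_shape)

text \<open>Since \<open>pair_shape 0\<close> has only identities, a cone over it is just a pair of
  arrows. \<open>C\<close> is kept arbitrary so that the result applies to \<open>opp C\<close> as
  well, which yields coproducts; \<open>ex_equalizer\<close> is stated in the same way to yield
  coequalizers.\<close>

lemma ex_product:
  fixes C :: "('o, 'm) cat" (structure)
  assumes "category C" "finitely_complete C" "A \<in> Obj C" "B \<in> Obj C"
  shows "\<exists>P p q. is_product C A B P p q"
proof -
  interpret category C by fact
  define J where "J = pair_shape 0"
  define F0 :: "nat \<Rightarrow> 'o" where "F0 x = (if x = 0 then A else B)" for x
  define F1 :: "nat \<Rightarrow> 'm" where "F1 m = idt C (if m = 0 then A else B)" for m
  have "is_functor J C F0 F1"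
    using assms(3,4)
    by (auto simp: is_functor_def J_def pair_shape_def hom_def F0_def F1_def split: if_splits)
  moreover have "category J" "finite (Obj J)" "finite (Arr J)"
    using category_pair_shape by (simp_all add: J_def) (simp_all add: pair_shape_def)
  ultimately obtain L p where lim: "is_limit J C F0 F1 L p"
    using assms(2) unfolding finitely_complete_def by blast
  have cone: "is_cone J C F0 F1 X q \<longleftrightarrow> q 0 \<in> hom C X A \<and> q 1 \<in> hom C X B" for X q
    using assms(3,4)
    by (auto simp: is_cone_def J_def pair_shape_def hom_def F0_def F1_def split: if_splits)
  have objJ: "Obj J = {0, 1}" by (simp add: J_def pair_shape_def)
  have "is_product C A B L (p 0) (p 1)"
    unfolding is_product_def
  proof (intro conjI allI ballI)
    fix X f g assume fg: "f \<in> hom C X A" "g \<in> hom C X B"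
    define q where "q x = (if x = (0::nat) then f else g)" for x
    have "is_cone J C F0 F1 X q" using fg by (simp add: cone q_def)
    then have "\<exists>!h. h \<in> hom C X L \<and> (\<forall>x\<in>Obj J. p x \<cdot> h = q x)"
      using lim unfolding is_limit_def by blast
    then show "\<exists>!h. h \<in> hom C X L \<and> p 0 \<cdot> h = f \<and> p 1 \<cdot> h = g"
      by (simp add: objJ q_def)
  qed (use lim cone in \<open>auto simp: is_limit_def\<close>)
  then show ?thesis by blast
qed

lemma ex_equalizer:
  fixes C :: "('o, 'm) cat" (structure)
  assumes "category C" "finitely_complete C" "f \<in> hom C A B" "g \<in> hom C A B"
  shows "\<exists>E e. e \<in> hom C E A \<and> f \<cdot>\<^bsub>C\<^esub> e = g \<cdot>\<^bsub>C\<^esub> e \<and>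
    (\<forall>X. \<forall>u\<in>hom C X A. f \<cdot>\<^bsub>C\<^esub> u = g \<cdot>\<^bsub>C\<^esub> u \<longrightarrow> (\<exists>!h. h \<in> hom C X E \<and> e \<cdot>\<^bsub>C\<^esub> h = u))"
proof -
  interpret category C by fact
  define J where "J = pair_shape 2"
  define F0 :: "nat \<Rightarrow> 'o" where "F0 x = (if x = 0 then A else B)" for x
  define F1 :: "nat \<Rightarrow> 'm" where
    "F1 m = (if m = 0 then idt C A else if m = 1 then idt C B else if m = 2 then f else g)" for m
  have AB: "A \<in> Obj C" "B \<in> Obj C" using assms(3) by (auto simp: in_hom)
  have "is_functor J C F0 F1"
    using assms(3,4) AB
    by (auto simp: is_functor_def J_def pair_shape_def hom_def F0_def F1_def split: if_splits)
  moreover have "category J" "finite (Obj J)" "finite (Arr J)"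
    using category_pair_shape by (simp_all add: J_def) (simp_all add: pair_shape_def)
  ultimately obtain L p where lim: "is_limit J C F0 F1 L p"
    using assms(2) unfolding finitely_complete_def by blast
  have arrJ: "hom J 0 1 = {2, 3}" "hom J 0 0 = {0}" "hom J 1 1 = {1}" "hom J 1 0 = {}"
    by (auto simp: J_def pair_shape_def hom_def split: if_splits)
  have homJ: "k \<in> hom J x y \<Longrightarrow> x \<in> {0, 1} \<and> y \<in> {0, 1}" for k x y
    by (auto simp: J_def pair_shape_def hom_def split: if_splits)
  have objJ: "Obj J = {0, 1}" by (simp add: J_def pair_shape_def)
  have cone: "is_cone J C F0 F1 X q \<longleftrightarrow> q 0 \<in> hom C X A \<and> f \<cdot> q 0 = q 1 \<and> g \<cdot> q 0 = q 1" for X q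
  proof
    assume q: "is_cone J C F0 F1 X q"
    then have *: "F1 m \<cdot> q 0 = q 1" if "m \<in> {2, 3}" for m
      using that arrJ(1) unfolding is_cone_def by blast
    show "q 0 \<in> hom C X A \<and> f \<cdot> q 0 = q 1 \<and> g \<cdot> q 0 = q 1"
      using q *[of 2] *[of 3] by (auto simp: is_cone_def objJ F0_def F1_def)
  next
    assume q: "q 0 \<in> hom C X A \<and> f \<cdot> q 0 = q 1 \<and> g \<cdot> q 0 = q 1"
    have "q 1 \<in> hom C X B" using q assms(3) by (metis Comp_hom)
    moreover have "F1 k \<cdot> q x = q y" if "k \<in> hom J x y" for k x y
      using homJ[OF that] that q \<open>q 1 \<in> hom C X B\<close> by (auto simp: arrJ F1_def in_hom simp del: One_nat_def)
    ultimately show "is_cone J C F0 F1 X q"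
      using q unfolding is_cone_def by (auto simp: objJ F0_def in_hom)
  qed
  have p: "p 0 \<in> hom C L A" "f \<cdot> p 0 = p 1" "g \<cdot> p 0 = p 1"
    using lim cone by (auto simp: is_limit_def)
  have "\<exists>!h. h \<in> hom C X L \<and> p 0 \<cdot> h = u" if u: "u \<in> hom C X A" "f \<cdot> u = g \<cdot> u" for X u
  proof -
    define q where "q x = (if x = (0::nat) then u else f \<cdot> u)" for x
    have "is_cone J C F0 F1 X q" using u by (simp add: cone q_def)
    then have "\<exists>!h. h \<in> hom C X L \<and> (\<forall>x\<in>Obj J. p x \<cdot> h = q x)"
      using lim unfolding is_limit_def by blast
    \<comment> \<open>The leg at the object 1 is determined by the leg at 0, so the limit property
      reduces to a condition on \<open>p 0\<close> alone.\<close>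
    moreover have "p 1 \<cdot> h = f \<cdot> u" if "h \<in> hom C X L" "p 0 \<cdot> h = u" for h
      using that p assms(3) by (metis Comp_assoc)
    then have "h \<in> hom C X L \<and> (\<forall>x\<in>Obj J. p x \<cdot> h = q x) \<longleftrightarrow> h \<in> hom C X L \<and> p 0 \<cdot> h = u" for h
      by (auto simp: objJ q_def simp del: One_nat_def)
    ultimately show ?thesis by simp
  qed
  then show ?thesis using p by (intro exI[of _ L] exI[of _ "p 0"]) simp
qed


context semi_abelian
begin

section \<open>Zero objects and zero arrows\<close>

lemma ex_zero: "\<exists>Z. is_zero C Z"
  using pointed by (simp add: pointed_def)

lemma zero_ex:
  assumes "is_zero C Z" "A \<in> Obj C"
  shows "\<exists>u. u \<in> hom C A Z" "\<exists>v. v \<in> hom C Z A"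
  using assms unfolding is_zero_def is_initial_def is_terminal_def by (metis+)

lemma zero_unique:
  assumes "is_zero C Z" "A \<in> Obj C"
  shows "u \<in> hom C A Z \<Longrightarrow> u' \<in> hom C A Z \<Longrightarrow> u = u'" "v \<in> hom C Z A \<Longrightarrow> v' \<in> hom C Z A \<Longrightarrow> v = v'"
  using assms unfolding is_zero_def is_initial_def is_terminal_def by (metis+)

text \<open>The definite description in \<open>zero_arr\<close> ranges over all zero objects, so it
  needs independence of the one chosen: the comparison \<open>w\<close> between two zero objects is
  compatible with all arrows into and out of them.\<close>

lemma zero_arr_unique:
  assumes 1: "is_zero C Z1" "u1 \<in> hom C A Z1" "v1 \<in> hom C Z1 B"
    and 2: "is_zero C Z2" "u2 \<in> hom C A Z2" "v2 \<in> hom C Z2 B"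
  shows "v1 \<cdot> u1 = v2 \<cdot> u2"
proof -
  have AB: "A \<in> Obj C" "B \<in> Obj C" using 1 by (auto simp: in_hom)
  have "Z2 \<in> Obj C" using 2 by (auto simp: in_hom)
  then obtain w where w: "w \<in> hom C Z1 Z2"
    using zero_ex(2)[OF 1(1)] by blast
  have "w \<cdot> u1 = u2"
    by (rule zero_unique(1)[OF 2(1) AB(1) Comp_hom[OF 1(2) w] 2(2)])
  moreover have "v2 \<cdot> w = v1"
    by (rule zero_unique(2)[OF 1(1) AB(2) Comp_hom[OF w 2(3)] 1(3)])
  ultimately show ?thesis using Comp_assoc[OF 1(2) w 2(3)] by simp
qed

lemma zero_arr_ex1:
  assumes "A \<in> Obj C" "B \<in> Obj C"
  shows "\<exists>!f. \<exists>Z. is_zero C Z \<and> (\<exists>u\<in>hom C A Z. \<exists>v\<in>hom C Z B. f = v \<cdot> u)"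
proof -
  obtain Z where Z: "is_zero C Z" using ex_zero by blast
  obtain u v where "u \<in> hom C A Z" "v \<in> hom C Z B"
    using zero_ex(1)[OF Z assms(1)] zero_ex(2)[OF Z assms(2)] by blast
  then show ?thesis using Z zero_arr_unique by (intro ex_ex1I) blast+
qed

lemma zero_arr_factor:
  assumes "A \<in> Obj C" "B \<in> Obj C"
  shows "\<exists>Z. is_zero C Z \<and> (\<exists>u\<in>hom C A Z. \<exists>v\<in>hom C Z B. zero_arr C A B = v \<cdot> u)"
  unfolding zero_arr_def by (rule theI') (rule zero_arr_ex1[OF assms])

lemma zero_arr_eqI:
  assumes "is_zero C Z" "u \<in> hom C A Z" "v \<in> hom C Z B"
  shows "v \<cdot> u = zero_arr C A B"
proof -
  have "A \<in> Obj C" "B \<in> Obj C" using assms by (auto simp: in_hom)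
  from zero_arr_factor[OF this] obtain Z' u' v' where
    "is_zero C Z'" "u' \<in> hom C A Z'" "v' \<in> hom C Z' B" "zero_arr C A B = v' \<cdot> u'"
    by (elim exE conjE bexE)
  then show ?thesis using zero_arr_unique[OF assms] by simp
qed

lemma zero_arr_simps [simp]:
  assumes "A \<in> Obj C" "B \<in> Obj C"
  shows "zero_arr C A B \<in> Arr C" "Dom C (zero_arr C A B) = A" "Cod C (zero_arr C A B) = B"
  using zero_arr_factor[OF assms] by (auto simp: in_hom)

lemma Comp_zero [simp]:
  assumes "A \<in> Obj C" "f \<in> Arr C" "Dom C f = B"
  shows "f \<cdot> zero_arr C A B = zero_arr C A (Cod C f)"
proof -
  have "B \<in> Obj C" using assms by auto
  then obtain Z u v where *: "is_zero C Z" "u \<in> hom C A Z" "v \<in> hom C Z B" "zero_arr C A B = v \<cdot> u"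
    using zero_arr_factor[OF assms(1)] by metis
  then have "f \<cdot> v \<in> hom C Z (Cod C f)" using assms by (auto simp: in_hom)
  from zero_arr_eqI[OF *(1,2) this] show ?thesis using * assms by (auto simp: in_hom)
qed

lemma zero_Comp [simp]:
  assumes "B \<in> Obj C" "f \<in> Arr C" "Cod C f = A"
  shows "zero_arr C A B \<cdot> f = zero_arr C (Dom C f) B"
proof -
  have "A \<in> Obj C" using assms by auto
  then obtain Z u v where *: "is_zero C Z" "u \<in> hom C A Z" "v \<in> hom C Z B" "zero_arr C A B = v \<cdot> u"
    using zero_arr_factor[OF _ assms(1)] by metis
  then have "u \<cdot> f \<in> hom C (Dom C f) Z" using assms by (auto simp: in_hom)
  from zero_arr_eqI[OF *(1) this *(3)] show ?thesis using * assms by (auto simp: in_hom)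
qed

section \<open>Chosen products\<close>

lemma is_product_product:
  assumes "A \<in> Obj C" "B \<in> Obj C"
  shows "is_product C A B (prod_obj C A B) (proj1 C A B) (proj2 C A B)"
proof -
  obtain P p q where "is_product C A B P p q"
    using ex_product[OF category_axioms finitely_complete assms] by (elim exE)
  then have "\<exists>x. case x of (P, p, q) \<Rightarrow> is_product C A B P p q" by auto
  then have "case product C A B of (P, p, q) \<Rightarrow> is_product C A B P p q"
    unfolding product_def by (rule someI_ex)
  then show ?thesis by (simp add: prod_obj_def proj1_def proj2_def split_beta)
qed

lemma proj_simps [simp]:
  assumes "A \<in> Obj C" "B \<in> Obj C"
  shows "proj1 C A B \<in> Arr C" "proj2 C A B \<in> Arr C"
    "Dom C (proj1 C A B) = prod_obj C A B" "Dom C (proj2 C A B) = prod_obj C A B"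
    "Cod C (proj1 C A B) = A" "Cod C (proj2 C A B) = B"
  using is_product_product[OF assms] by (auto simp: is_product_def in_hom)

lemma prod_obj [simp]: "A \<in> Obj C \<Longrightarrow> B \<in> Obj C \<Longrightarrow> prod_obj C A B \<in> Obj C"
  using Dom_Obj[of "proj1 C A B"] by simp

lemma pairing:
  assumes "f \<in> Arr C" "g \<in> Arr C" "Dom C f = Dom C g"
  shows "pairing C f g \<in> hom C (Dom C f) (prod_obj C (Cod C f) (Cod C g)) \<and>
    proj1 C (Cod C f) (Cod C g) \<cdot> pairing C f g = f \<and> proj2 C (Cod C f) (Cod C g) \<cdot> pairing C f g = g"
proof -
  have "\<exists>!h. h \<in> hom C (Dom C f) (prod_obj C (Cod C f) (Cod C g)) \<and>
    proj1 C (Cod C f) (Cod C g) \<cdot> h = f \<and> proj2 C (Cod C f) (Cod C g) \<cdot> h = g"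
    using is_product_product[of "Cod C f" "Cod C g"] assms by (auto simp: is_product_def in_hom)
  then show ?thesis unfolding pairing_def by (rule theI')
qed

lemma pairing_simps [simp]:
  assumes "f \<in> Arr C" "g \<in> Arr C" "Dom C f = Dom C g"
  shows "pairing C f g \<in> Arr C" "Dom C (pairing C f g) = Dom C g"
    "Cod C (pairing C f g) = prod_obj C (Cod C f) (Cod C g)"
    "\<lbrakk>A = Cod C f; B = Cod C g\<rbrakk> \<Longrightarrow> proj1 C A B \<cdot> pairing C f g = f"
    "\<lbrakk>A = Cod C f; B = Cod C g\<rbrakk> \<Longrightarrow> proj2 C A B \<cdot> pairing C f g = g"
  using pairing[OF assms] assms(3) by (auto simp: in_hom)

lemma proj_pairing_Comp [simp]:
  assumes "f \<in> Arr C" "g \<in> Arr C" "Dom C f = Dom C g" "x \<in> Arr C" "Cod C x = Dom C g"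
    "A = Cod C f" "B = Cod C g"
  shows "proj1 C A B \<cdot> (pairing C f g \<cdot> x) = f \<cdot> x" "proj2 C A B \<cdot> (pairing C f g \<cdot> x) = g \<cdot> x"
  using assms reassoc[OF pairing_simps(4), OF assms(1-3,6,7), of x]
    reassoc[OF pairing_simps(5), OF assms(1-3,6,7), of x] by simp_all

lemma prod_ext:
  assumes "proj1 C A B \<cdot> f = proj1 C A B \<cdot> g" "proj2 C A B \<cdot> f = proj2 C A B \<cdot> g"
    "A \<in> Obj C" "B \<in> Obj C" "f \<in> Arr C" "g \<in> Arr C" "Dom C f = Dom C g"
    "Cod C f = prod_obj C A B" "Cod C g = prod_obj C A B"
  shows "f = g"
proof -
  have "\<exists>!h. h \<in> hom C (Dom C f) (prod_obj C A B) \<and>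
      proj1 C A B \<cdot> h = proj1 C A B \<cdot> f \<and> proj2 C A B \<cdot> h = proj2 C A B \<cdot> f"
    using is_product_product[OF assms(3,4)] assms(3-9)
    unfolding is_product_def by (simp add: in_hom)
  moreover have "f \<in> hom C (Dom C f) (prod_obj C A B)" "g \<in> hom C (Dom C f) (prod_obj C A B)"
    using assms(3-9) by (simp_all add: in_hom)
  ultimately show ?thesis using assms(1,2) by metis
qed

section \<open>Chosen coproducts, as products in the opposite category\<close>

lemma is_coproduct_coproduct:
  assumes "A \<in> Obj C" "B \<in> Obj C"
  shows "is_coproduct C A B (coprod_obj C A B) (inj1 C A B) (inj2 C A B)"
proof -
  have "A \<in> Obj (opp C)" "B \<in> Obj (opp C)" using assms by (simp_all add: opp_def)
  then obtain P p q where "is_product (opp C) A B P p q"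
    using ex_product[OF category_opp] finitely_cocomplete unfolding finitely_cocomplete_def by blast
  then have "is_coproduct C A B P p q"
    by (simp add: is_product_def is_coproduct_def hom_opp Comp_opp)
  then have "\<exists>x. case x of (P, p, q) \<Rightarrow> is_coproduct C A B P p q" by auto
  then have "case coproduct C A B of (P, p, q) \<Rightarrow> is_coproduct C A B P p q"
    unfolding coproduct_def by (rule someI_ex)
  then show ?thesis by (simp add: coprod_obj_def inj1_def inj2_def split_beta)
qed

lemma inj_simps [simp]:
  assumes "A \<in> Obj C" "B \<in> Obj C"
  shows "inj1 C A B \<in> Arr C" "inj2 C A B \<in> Arr C"
    "Cod C (inj1 C A B) = coprod_obj C A B" "Cod C (inj2 C A B) = coprod_obj C A B"
    "Dom C (inj1 C A B) = A" "Dom C (inj2 C A B) = B"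
  using is_coproduct_coproduct[OF assms] by (auto simp: is_coproduct_def in_hom)

lemma coprod_obj [simp]: "A \<in> Obj C \<Longrightarrow> B \<in> Obj C \<Longrightarrow> coprod_obj C A B \<in> Obj C"
  using Cod_Obj[of "inj1 C A B"] by simp

lemma copairing:
  assumes "f \<in> Arr C" "g \<in> Arr C" "Cod C f = Cod C g"
  shows "copairing C f g \<in> hom C (coprod_obj C (Dom C f) (Dom C g)) (Cod C f) \<and>
    copairing C f g \<cdot> inj1 C (Dom C f) (Dom C g) = f \<and> copairing C f g \<cdot> inj2 C (Dom C f) (Dom C g) = g"
proof -
  have "\<exists>!h. h \<in> hom C (coprod_obj C (Dom C f) (Dom C g)) (Cod C f) \<and>
    h \<cdot> inj1 C (Dom C f) (Dom C g) = f \<and> h \<cdot> inj2 C (Dom C f) (Dom C g) = g"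
    using is_coproduct_coproduct[of "Dom C f" "Dom C g"] assms by (auto simp: is_coproduct_def in_hom)
  then show ?thesis unfolding copairing_def by (rule theI')
qed

lemma copairing_simps [simp]:
  assumes "f \<in> Arr C" "g \<in> Arr C" "Cod C f = Cod C g"
  shows "copairing C f g \<in> Arr C" "Cod C (copairing C f g) = Cod C g"
    "Dom C (copairing C f g) = coprod_obj C (Dom C f) (Dom C g)"
    "\<lbrakk>A = Dom C f; B = Dom C g\<rbrakk> \<Longrightarrow> copairing C f g \<cdot> inj1 C A B = f"
    "\<lbrakk>A = Dom C f; B = Dom C g\<rbrakk> \<Longrightarrow> copairing C f g \<cdot> inj2 C A B = g"
  using copairing[OF assms] assms(3) by (auto simp: in_hom)

lemma copairing_inj_Comp [simp]:
  assumes "f \<in> Arr C" "g \<in> Arr C" "Cod C f = Cod C g" "x \<in> Arr C" "A = Dom C f" "B = Dom C g"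
  shows "Cod C x = A \<Longrightarrow> copairing C f g \<cdot> (inj1 C A B \<cdot> x) = f \<cdot> x"
    "Cod C x = B \<Longrightarrow> copairing C f g \<cdot> (inj2 C A B \<cdot> x) = g \<cdot> x"
  using assms reassoc[OF copairing_simps(4), OF assms(1-3,5,6), of x]
    reassoc[OF copairing_simps(5), OF assms(1-3,5,6), of x] by simp_all

lemma coprod_ext:
  assumes "f \<cdot> inj1 C A B = g \<cdot> inj1 C A B" "f \<cdot> inj2 C A B = g \<cdot> inj2 C A B"
    "A \<in> Obj C" "B \<in> Obj C" "f \<in> Arr C" "g \<in> Arr C" "Cod C f = Cod C g"
    "Dom C f = coprod_obj C A B" "Dom C g = coprod_obj C A B"
  shows "f = g"
proof -
  have "\<exists>!h. h \<in> hom C (coprod_obj C A B) (Cod C f) \<and>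
      h \<cdot> inj1 C A B = f \<cdot> inj1 C A B \<and> h \<cdot> inj2 C A B = f \<cdot> inj2 C A B"
    using is_coproduct_coproduct[OF assms(3,4)] assms(3-9)
    unfolding is_coproduct_def by (simp add: in_hom)
  moreover have "f \<in> hom C (coprod_obj C A B) (Cod C f)" "g \<in> hom C (coprod_obj C A B) (Cod C f)"
    using assms(3-9) by (simp_all add: in_hom)
  ultimately show ?thesis using assms(1,2) by metis
qed

lemma Comp_copairing:
  assumes "f \<in> Arr C" "g \<in> Arr C" "h \<in> Arr C" "Cod C f = Cod C g" "Dom C h = Cod C g"
  shows "h \<cdot> copairing C f g = copairing C (h \<cdot> f) (h \<cdot> g)"
  by (rule coprod_ext[of _ "Dom C f" "Dom C g"]) (use assms in simp_all)

lemma coprod_map_simps [simp]: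
  assumes "f \<in> Arr C" "g \<in> Arr C"
  shows "coprod_map C f g \<in> Arr C" "Dom C (coprod_map C f g) = coprod_obj C (Dom C f) (Dom C g)"
    "Cod C (coprod_map C f g) = coprod_obj C (Cod C f) (Cod C g)"
    "\<lbrakk>A = Dom C f; B = Dom C g\<rbrakk> \<Longrightarrow> coprod_map C f g \<cdot> inj1 C A B = inj1 C (Cod C f) (Cod C g) \<cdot> f"
    "\<lbrakk>A = Dom C f; B = Dom C g\<rbrakk> \<Longrightarrow> coprod_map C f g \<cdot> inj2 C A B = inj2 C (Cod C f) (Cod C g) \<cdot> g"
  using assms by (simp_all add: coprod_map_def)

lemma copairing_coprod_map:
  assumes "f \<in> Arr C" "g \<in> Arr C" "u \<in> Arr C" "v \<in> Arr C"
    "Cod C u = Cod C v" "Cod C f = Dom C u" "Cod C g = Dom C v"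
  shows "copairing C u v \<cdot> coprod_map C f g = copairing C (u \<cdot> f) (v \<cdot> g)"
  by (rule coprod_ext[of _ "Dom C f" "Dom C g"]) (use assms in simp_all)

section \<open>Equalizers, pullbacks and coequalizers\<close>

lemma equalizer_ex:
  assumes "f \<in> hom C A B" "g \<in> hom C A B"
  obtains e where "e \<in> Arr C" "Cod C e = A" "f \<cdot> e = g \<cdot> e" "is_mono C e"
    "\<And>u. u \<in> Arr C \<Longrightarrow> Cod C u = A \<Longrightarrow> f \<cdot> u = g \<cdot> u \<Longrightarrow> \<exists>h\<in>hom C (Dom C u) (Dom C e). e \<cdot> h = u"
proof -
  obtain E e where e: "e \<in> hom C E A" "f \<cdot> e = g \<cdot> e"
    "\<And>X u. u \<in> hom C X A \<Longrightarrow> f \<cdot> u = g \<cdot> u \<Longrightarrow> \<exists>!h. h \<in> hom C X E \<and> e \<cdot> h = u"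
    using ex_equalizer[OF category_axioms finitely_complete assms] by metis
  have "is_mono C e"
  proof (rule monoI)
    fix u v assume uv: "u \<in> Arr C" "v \<in> Arr C" "Dom C u = Dom C v" "Cod C u = Dom C e"
      "Cod C v = Dom C e" "e \<cdot> u = e \<cdot> v"
    have "f \<cdot> (e \<cdot> u) = g \<cdot> (e \<cdot> u)"
      using reassoc[OF e(2), of u] uv e(1) assms by (simp add: in_hom)
    then have "\<exists>!h. h \<in> hom C (Dom C u) E \<and> e \<cdot> h = e \<cdot> u"
      using uv e(1) by (intro e(3)) (simp_all add: in_hom)
    moreover have "u \<in> hom C (Dom C u) E" "v \<in> hom C (Dom C u) E"
      using uv e(1) by (simp_all add: in_hom)
    ultimately show "u = v" using uv(6) by metis
  qed (use e(1) in \<open>simp add: in_hom\<close>)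
  moreover have "\<exists>h\<in>hom C (Dom C u) (Dom C e). e \<cdot> h = u"
    if "u \<in> Arr C" "Cod C u = A" "f \<cdot> u = g \<cdot> u" for u
  proof -
    have "u \<in> hom C (Dom C u) A" using that by (simp add: in_hom)
    from ex1_implies_ex[OF e(3)[OF this that(3)]] show ?thesis
      using e(1) by (simp add: in_hom Bex_def)
  qed
  ultimately show thesis
    using e(1,2) that unfolding in_hom by blast
qed

lemma is_pullbackI:
  assumes "f \<in> Arr C" "g \<in> Arr C" "p \<in> Arr C" "q \<in> Arr C" "Cod C f = Cod C g" "Dom C p = Dom C q"
    "Cod C p = Dom C f" "Cod C q = Dom C g" "f \<cdot> p = g \<cdot> q"
    and "\<And>u v. \<lbrakk>u \<in> Arr C; v \<in> Arr C; Dom C u = Dom C v; Cod C u = Dom C f; Cod C v = Dom C g;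
      f \<cdot> u = g \<cdot> v\<rbrakk> \<Longrightarrow> \<exists>h\<in>hom C (Dom C v) (Dom C q). p \<cdot> h = u \<and> q \<cdot> h = v"
    and "\<And>u v. \<lbrakk>u \<in> Arr C; v \<in> Arr C; Dom C u = Dom C v; Cod C u = Dom C p; Cod C v = Dom C p;
      p \<cdot> u = p \<cdot> v; q \<cdot> u = q \<cdot> v\<rbrakk> \<Longrightarrow> u = v"
  shows "is_pullback C f g p q"
  unfolding is_pullback_def
proof (intro exI conjI allI ballI impI)
  fix Z u v assume "u \<in> hom C Z (Dom C f)" "v \<in> hom C Z (Dom C g)" "f \<cdot> u = g \<cdot> v"
  then show "\<exists>!h. h \<in> hom C Z (Dom C p) \<and> p \<cdot> h = u \<and> q \<cdot> h = v"
    using assms(10)[of u v] assms(11) assms(6) by (intro ex_ex1I) (auto simp: in_hom)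
qed (use assms(1-9) in \<open>auto simp: in_hom\<close>)

lemma is_pullbackD:
  assumes "is_pullback C f g p q"
  shows "f \<in> Arr C" "g \<in> Arr C" "p \<in> Arr C" "q \<in> Arr C" "Cod C f = Cod C g" "Dom C p = Dom C q"
    "Cod C p = Dom C f" "Cod C q = Dom C g" "f \<cdot> p = g \<cdot> q"
  using assms by (auto simp: is_pullback_def in_hom)

lemma pullback_ex1:
  assumes "is_pullback C f g p q" "u \<in> Arr C" "v \<in> Arr C" "Dom C u = Dom C v"
    "Cod C u = Dom C f" "Cod C v = Dom C g" "f \<cdot> u = g \<cdot> v"
  shows "\<exists>!h. h \<in> hom C (Dom C v) (Dom C q) \<and> p \<cdot> h = u \<and> q \<cdot> h = v"
  using assms(1) unfolding is_pullback_def
proof (elim exE conjE)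
  fix A B X P
  assume H: "f \<in> hom C A X" "g \<in> hom C B X" "q \<in> hom C P B"
    and *: "\<forall>Z. \<forall>u\<in>hom C Z A. \<forall>v\<in>hom C Z B. f \<cdot> u = g \<cdot> v \<longrightarrow>
      (\<exists>!h. h \<in> hom C Z P \<and> p \<cdot> h = u \<and> q \<cdot> h = v)"
  have eq: "A = Dom C f" "B = Dom C g" "P = Dom C q" using H by (simp_all add: in_hom)
  have "u \<in> hom C (Dom C v) A" "v \<in> hom C (Dom C v) B"
    using assms eq by (simp_all add: in_hom)
  from *[rule_format, OF this assms(7)] show ?thesis unfolding eq .
qed

lemma pullback_lift:
  assumes "is_pullback C f g p q" "u \<in> Arr C" "v \<in> Arr C" "Dom C u = Dom C v"
    "Cod C u = Dom C f" "Cod C v = Dom C g" "f \<cdot> u = g \<cdot> v"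
  obtains h where "h \<in> Arr C" "Dom C h = Dom C v" "Cod C h = Dom C q" "p \<cdot> h = u" "q \<cdot> h = v"
  using ex1_implies_ex[OF pullback_ex1[OF assms]] that by (auto simp: in_hom)

lemma pullback_ext:
  assumes "is_pullback C f g p q" "u \<in> Arr C" "v \<in> Arr C" "Dom C u = Dom C v"
    "Cod C u = Dom C p" "Cod C v = Dom C p" "p \<cdot> u = p \<cdot> v" "q \<cdot> u = q \<cdot> v"
  shows "u = v"
proof -
  note D = is_pullbackD[OF assms(1)]
  have "f \<cdot> (p \<cdot> u) = g \<cdot> (q \<cdot> u)"
    using reassoc[OF D(9), of u] D assms(2-6) by simp
  then have "\<exists>!h. h \<in> hom C (Dom C u) (Dom C q) \<and> p \<cdot> h = p \<cdot> u \<and> q \<cdot> h = q \<cdot> u"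
    using pullback_ex1[OF assms(1), of "p \<cdot> u" "q \<cdot> u"] D assms(2-6) by simp
  moreover have "u \<in> hom C (Dom C u) (Dom C q)" "v \<in> hom C (Dom C u) (Dom C q)"
    using assms(2-6) D by (simp_all add: in_hom)
  ultimately show ?thesis using assms(7,8) by metis
qed

lemma pullback_ex:
  assumes "f \<in> Arr C" "g \<in> Arr C" "Cod C f = Cod C g"
  obtains p q where "is_pullback C f g p q"
proof -
  let ?A = "Dom C f" and ?B = "Dom C g"
  have "f \<cdot> proj1 C ?A ?B \<in> hom C (prod_obj C ?A ?B) (Cod C f)"
    "g \<cdot> proj2 C ?A ?B \<in> hom C (prod_obj C ?A ?B) (Cod C f)"
    using assms by (simp_all add: in_hom)
  then obtain e where e: "e \<in> Arr C" "Cod C e = prod_obj C ?A ?B"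
    "(f \<cdot> proj1 C ?A ?B) \<cdot> e = (g \<cdot> proj2 C ?A ?B) \<cdot> e" "is_mono C e"
    "\<And>u. u \<in> Arr C \<Longrightarrow> Cod C u = prod_obj C ?A ?B \<Longrightarrow>
      (f \<cdot> proj1 C ?A ?B) \<cdot> u = (g \<cdot> proj2 C ?A ?B) \<cdot> u \<Longrightarrow> \<exists>h\<in>hom C (Dom C u) (Dom C e). e \<cdot> h = u"
    using equalizer_ex by metis
  have "is_pullback C f g (proj1 C ?A ?B \<cdot> e) (proj2 C ?A ?B \<cdot> e)"
  proof (rule is_pullbackI)
    fix u v assume uv: "u \<in> Arr C" "v \<in> Arr C" "Dom C u = Dom C v" "Cod C u = Dom C f"
      "Cod C v = Dom C g" "f \<cdot> u = g \<cdot> v"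
    then obtain h where h: "h \<in> hom C (Dom C (pairing C u v)) (Dom C e)" "e \<cdot> h = pairing C u v"
      using e(5)[of "pairing C u v"] assms by auto
    then show "\<exists>h\<in>hom C (Dom C v) (Dom C (proj2 C ?A ?B \<cdot> e)).
        (proj1 C ?A ?B \<cdot> e) \<cdot> h = u \<and> (proj2 C ?A ?B \<cdot> e) \<cdot> h = v"
      using uv assms e(1,2) by (intro bexI[of _ h]) (auto simp: in_hom)
  next
    fix u v assume uv: "u \<in> Arr C" "v \<in> Arr C" "Dom C u = Dom C v"
      "Cod C u = Dom C (proj1 C ?A ?B \<cdot> e)" "Cod C v = Dom C (proj1 C ?A ?B \<cdot> e)"
      "(proj1 C ?A ?B \<cdot> e) \<cdot> u = (proj1 C ?A ?B \<cdot> e) \<cdot> v"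
      "(proj2 C ?A ?B \<cdot> e) \<cdot> u = (proj2 C ?A ?B \<cdot> e) \<cdot> v"
    have "e \<cdot> u = e \<cdot> v"
      by (rule prod_ext[of ?A ?B]) (use uv e(1,2) assms in simp_all)
    then show "u = v" by (rule monoD[OF e(4)]) (use uv e(1,2) assms in simp_all)
  qed (use e(1-3) assms in simp_all)
  then show thesis by (rule that)
qed

lemma coequalizer_ex:
  assumes "f \<in> hom C X Y" "g \<in> hom C X Y"
  shows "is_coequalizer C f g (coequalizer C f g)"
proof -
  have "f \<in> hom (opp C) Y X" "g \<in> hom (opp C) Y X" using assms by (simp_all add: hom_opp)
  from ex_equalizer[OF category_opp finitely_cocomplete[unfolded finitely_cocomplete_def] this]
  have "\<exists>q. is_coequalizer C f g q"
    unfolding hom_opp Comp_opp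
  proof (elim exE conjE)
    fix Q q
    assume "q \<in> hom C Y Q" "q \<cdot> f = q \<cdot> g"
      "\<forall>Z. \<forall>u\<in>hom C Y Z. u \<cdot> f = u \<cdot> g \<longrightarrow> (\<exists>!h. h \<in> hom C Q Z \<and> h \<cdot> q = u)"
    then show ?thesis using assms unfolding is_coequalizer_def
      by (intro exI[of _ q] exI[of _ X] exI[of _ Y] exI[of _ Q] conjI)
  qed
  then show ?thesis unfolding coequalizer_def by (rule someI_ex)
qed

lemma is_coequalizerD:
  assumes "is_coequalizer C f g q"
  shows "f \<in> Arr C" "g \<in> Arr C" "q \<in> Arr C" "Cod C f = Dom C q" "Cod C g = Dom C q" "Dom C f = Dom C g"
    "q \<cdot> f = q \<cdot> g"
  using assms by (auto simp: is_coequalizer_def in_hom)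

lemma coequalizer_ex1:
  assumes "is_coequalizer C f g q" "u \<in> Arr C" "Dom C u = Dom C q" "u \<cdot> f = u \<cdot> g"
  shows "\<exists>!v. v \<in> hom C (Cod C q) (Cod C u) \<and> v \<cdot> q = u"
  using assms(1) unfolding is_coequalizer_def
proof (elim exE conjE)
  fix X Y Q
  assume H: "q \<in> hom C Y Q"
    and *: "\<forall>Z. \<forall>u\<in>hom C Y Z. u \<cdot> f = u \<cdot> g \<longrightarrow> (\<exists>!v. v \<in> hom C Q Z \<and> v \<cdot> q = u)"
  have eq: "Y = Dom C q" "Q = Cod C q" using H by (simp_all add: in_hom)
  have "u \<in> hom C Y (Cod C u)" using assms eq by (simp add: in_hom)
  from *[rule_format, OF this assms(4)] show ?thesis unfolding eq .
qed

lemma coequalizer_desc: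
  assumes "is_coequalizer C f g q" "u \<in> Arr C" "Dom C u = Dom C q" "u \<cdot> f = u \<cdot> g"
  obtains v where "v \<in> Arr C" "Dom C v = Cod C q" "Cod C v = Cod C u" "v \<cdot> q = u"
  using ex1_implies_ex[OF coequalizer_ex1[OF assms]] that by (auto simp: in_hom)

lemma regular_epi_cancel:
  assumes "is_regular_epi C q" "u \<cdot> q = v \<cdot> q" "u \<in> Arr C" "v \<in> Arr C" "Dom C u = Cod C q"
    "Dom C v = Cod C q" "Cod C u = Cod C v"
  shows "u = v"
proof -
  obtain f g where c: "is_coequalizer C f g q" using assms(1) by (auto simp: is_regular_epi_def)
  note D = is_coequalizerD[OF c]
  have "(u \<cdot> q) \<cdot> f = (u \<cdot> q) \<cdot> g" using D assms(3,5) by simp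
  then have "\<exists>!h. h \<in> hom C (Cod C q) (Cod C u) \<and> h \<cdot> q = u \<cdot> q"
    using coequalizer_ex1[OF c, of "u \<cdot> q"] D assms(3-7) by simp
  moreover have "u \<in> hom C (Cod C q) (Cod C u)" "v \<in> hom C (Cod C q) (Cod C u)"
    using assms(3-7) by (simp_all add: in_hom)
  ultimately show ?thesis using assms(2) by metis
qed

end

section \<open>Kernels and points\<close>

context semi_abelian
begin

lemma is_kernelI:
  assumes "f \<in> Arr C" "k \<in> Arr C" "Cod C k = Dom C f" "f \<cdot> k = zero_arr C (Dom C k) (Cod C f)"
    "is_mono C k"
    and "\<And>u. \<lbrakk>u \<in> Arr C; Cod C u = Dom C f; f \<cdot> u = zero_arr C (Dom C u) (Cod C f)\<rbrakk> \<Longrightarrow>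
      \<exists>h. h \<in> hom C (Dom C u) (Dom C k) \<and> k \<cdot> h = u"
  shows "is_kernel C f k"
  unfolding is_kernel_def
proof (rule exI[of _ "Dom C k"], rule exI[of _ "Dom C f"], rule exI[of _ "Cod C f"],
    intro conjI allI ballI impI)
  fix Z u assume u: "u \<in> hom C Z (Dom C f)" "f \<cdot> u = zero_arr C Z (Cod C f)"
  show "\<exists>!h. h \<in> hom C Z (Dom C k) \<and> k \<cdot> h = u"
  proof (rule ex_ex1I)
    show "\<exists>h. h \<in> hom C Z (Dom C k) \<and> k \<cdot> h = u"
      using assms(6)[of u] u by (simp add: in_hom)
  next
    fix g h assume "g \<in> hom C Z (Dom C k) \<and> k \<cdot> g = u" "h \<in> hom C Z (Dom C k) \<and> k \<cdot> h = u"
    then show "g = h" by (intro monoD[OF assms(5), of g h]) (simp_all add: in_hom)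
  qed
qed (use assms(1-4) in \<open>simp_all add: in_hom\<close>)

lemma is_kernelD:
  assumes "is_kernel C f k"
  shows "f \<in> Arr C" "k \<in> Arr C" "Cod C k = Dom C f" "f \<cdot> k = zero_arr C (Dom C k) (Cod C f)"
  using assms by (auto simp: is_kernel_def in_hom)

lemma kernel_ex1:
  assumes "is_kernel C f k" "u \<in> Arr C" "Cod C u = Dom C f" "f \<cdot> u = zero_arr C (Dom C u) (Cod C f)"
  shows "\<exists>!h. h \<in> hom C (Dom C u) (Dom C k) \<and> k \<cdot> h = u"
  using assms(1) unfolding is_kernel_def
proof (elim exE conjE)
  fix K X Y
  assume H: "f \<in> hom C X Y" "k \<in> hom C K X"
    and *: "\<forall>Z. \<forall>u\<in>hom C Z X. f \<cdot> u = zero_arr C Z Y \<longrightarrow> (\<exists>!h. h \<in> hom C Z K \<and> k \<cdot> h = u)"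
  have eq: "X = Dom C f" "Y = Cod C f" "K = Dom C k" using H by (simp_all add: in_hom)
  have u: "u \<in> hom C (Dom C u) X" "f \<cdot> u = zero_arr C (Dom C u) Y"
    using assms eq by (simp_all add: in_hom)
  from *[rule_format, OF this] show ?thesis unfolding eq .
qed

lemma kernel_lift:
  assumes "is_kernel C f k" "u \<in> Arr C" "Cod C u = Dom C f" "f \<cdot> u = zero_arr C (Dom C u) (Cod C f)"
  obtains h where "h \<in> Arr C" "Dom C h = Dom C u" "Cod C h = Dom C k" "k \<cdot> h = u"
  using ex1_implies_ex[OF kernel_ex1[OF assms]] that by (auto simp: in_hom)

lemma kernel_mono:
  assumes "is_kernel C f k"
  shows "is_mono C k"
proof (rule monoI)
  note D = is_kernelD[OF assms]
  fix u v assume uv: "u \<in> Arr C" "v \<in> Arr C" "Dom C u = Dom C v" "Cod C u = Dom C k"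
    "Cod C v = Dom C k" "k \<cdot> u = k \<cdot> v"
  have "f \<cdot> (k \<cdot> u) = zero_arr C (Dom C u) (Cod C f)"
    using reassoc[OF D(4), of u] D(1-3) uv by simp
  then have "\<exists>!h. h \<in> hom C (Dom C u) (Dom C k) \<and> k \<cdot> h = k \<cdot> u"
    using kernel_ex1[OF assms, of "k \<cdot> u"] D(1-3) uv(1-5) by simp
  moreover have "u \<in> hom C (Dom C u) (Dom C k)" "v \<in> hom C (Dom C u) (Dom C k)"
    using uv(1-5) by (simp_all add: in_hom)
  ultimately show "u = v" using uv(6) by metis
qed (use is_kernelD[OF assms] in simp)

lemma is_kernel_kernel:
  assumes "f \<in> Arr C"
  shows "is_kernel C f (kernel C f)"
proof -
  have "f \<in> hom C (Dom C f) (Cod C f)" "zero_arr C (Dom C f) (Cod C f) \<in> hom C (Dom C f) (Cod C f)"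
    using assms by (simp_all add: in_hom)
  from equalizer_ex[OF this] obtain e where e: "e \<in> Arr C" "Cod C e = Dom C f"
    "f \<cdot> e = zero_arr C (Dom C f) (Cod C f) \<cdot> e" "is_mono C e"
    "\<And>u. u \<in> Arr C \<Longrightarrow> Cod C u = Dom C f \<Longrightarrow> f \<cdot> u = zero_arr C (Dom C f) (Cod C f) \<cdot> u \<Longrightarrow>
      \<exists>h\<in>hom C (Dom C u) (Dom C e). e \<cdot> h = u"
    by metis
  have "is_kernel C f e"
  proof (rule is_kernelI)
    fix u assume "u \<in> Arr C" "Cod C u = Dom C f" "f \<cdot> u = zero_arr C (Dom C u) (Cod C f)"
    then show "\<exists>h. h \<in> hom C (Dom C u) (Dom C e) \<and> e \<cdot> h = u"
      using e(5)[of u] assms by (simp add: Bex_def)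
  qed (use e(1-4) assms in simp_all)
  then show ?thesis unfolding kernel_def by (rule someI)
qed

text \<open>Protomodularity speaks of pullbacks along an arbitrary \<open>v\<close>. Taking
  \<open>v\<close> to be the arrow out of a zero object turns these pullbacks into kernels.\<close>

lemma kernel_pullback:
  assumes "is_kernel C p k" "is_zero C Z"
  shows "is_pullback C p (zero_arr C Z (Cod C p)) k (zero_arr C (Dom C k) Z)"
proof -
  note D = is_kernelD[OF assms(1)]
  have Z: "Z \<in> Obj C" using assms(2) by (simp add: is_zero_def is_initial_def)
  show ?thesis
  proof (rule is_pullbackI)
    fix u v assume uv: "u \<in> Arr C" "v \<in> Arr C" "Dom C u = Dom C v" "Cod C u = Dom C p"
      "Cod C v = Dom C (zero_arr C Z (Cod C p))" "p \<cdot> u = zero_arr C Z (Cod C p) \<cdot> v"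
    then have "p \<cdot> u = zero_arr C (Dom C u) (Cod C p)" using D Z by simp
    then obtain h where h: "h \<in> Arr C" "Dom C h = Dom C u" "Cod C h = Dom C k" "k \<cdot> h = u"
      using kernel_lift[OF assms(1) uv(1,4)] by metis
    have "zero_arr C (Dom C k) Z \<cdot> h = v"
      by (rule zero_unique(1)[OF assms(2), of "Dom C v"]) (use h D uv Z in \<open>simp_all add: in_hom\<close>)
    then show "\<exists>h\<in>hom C (Dom C v) (Dom C (zero_arr C (Dom C k) Z)).
        k \<cdot> h = u \<and> zero_arr C (Dom C k) Z \<cdot> h = v"
      using h D uv Z by (intro bexI[of _ h]) (simp_all add: in_hom)
  next
    fix u v assume "u \<in> Arr C" "v \<in> Arr C" "Dom C u = Dom C v" "Cod C u = Dom C k"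
      "Cod C v = Dom C k" "k \<cdot> u = k \<cdot> v"
    then show "u = v" by (intro monoD[OF kernel_mono[OF assms(1)], of u v])
  qed (use D Z in simp_all)
qed

section \<open>Points and the split short five lemma\<close>

lemma is_pointD:
  assumes "is_point C E Y p s"
  shows "p \<in> Arr C" "s \<in> Arr C" "Dom C p = E" "Cod C p = Y" "Dom C s = Y" "Cod C s = E"
    "p \<cdot> s = idt C Y" "E \<in> Obj C" "Y \<in> Obj C"
  using assms by (auto simp: is_point_def in_hom)

text \<open>Pullback along the arrow from a zero object replaces each point by its kernel. As
  \<open>f \<cdot> k\<close> itself serves as a kernel of \<open>p'\<close>, the map induced between
  the kernels is an identity, and protomodularity reflects this isomorphism to
  \<open>f\<close>.\<close>

lemma split_short_five:
  assumes "is_point C E Y p s" "is_point C E' Y p' s'" "f \<in> hom C E E'" "p' \<cdot> f = p" "f \<cdot> s = s'"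
    and "is_kernel C p k" "is_kernel C p' (f \<cdot> k)"
  shows "is_iso C f"
proof -
  obtain Z where Z: "is_zero C Z" using ex_zero by blast
  then have Z': "Z \<in> Obj C" by (simp add: is_zero_def is_initial_def)
  note P = is_pointD[OF assms(1)] and P' = is_pointD[OF assms(2)] and K = is_kernelD[OF assms(6)]
  let ?K = "Dom C k"
  have f: "f \<in> Arr C" "Dom C f = E" "Cod C f = E'" using assms(3) by (simp_all add: in_hom)
  have fk: "f \<cdot> k \<in> Arr C" "Dom C (f \<cdot> k) = ?K" "Cod C (f \<cdot> k) = E'"
    using f K P by simp_all
  have pb: "is_pullback C p (zero_arr C Z Y) k (zero_arr C ?K Z)"
    using kernel_pullback[OF assms(6) Z] P by simp
  have pb': "is_pullback C p' (zero_arr C Z Y) (f \<cdot> k) (zero_arr C ?K Z)"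
    using kernel_pullback[OF assms(7) Z] P' fk by simp
  have iso: "is_iso C (idt C ?K)"
    using K unfolding is_iso_def by (auto simp: in_hom intro!: bexI[of _ "idt C ?K"])
  show ?thesis
    by (rule protomodular[unfolded protomodular_def, rule_format,
          of "zero_arr C Z Y" Z Y E p s E' p' s' f k ?K "zero_arr C ?K Z" "f \<cdot> k" ?K
            "zero_arr C ?K Z" "idt C ?K"])
      (use assms(1-5) pb pb' iso P P' K f fk Z' in \<open>simp_all add: in_hom\<close>)
qed

lemma iso_inverse:
  assumes "is_iso C f"
  obtains g where "g \<in> Arr C" "Dom C g = Cod C f" "Cod C g = Dom C f"
    "g \<cdot> f = idt C (Dom C f)" "f \<cdot> g = idt C (Cod C f)" "f \<in> Arr C"
proof -
  from assms obtain g where "f \<in> Arr C" "g \<in> hom C (Cod C f) (Dom C f)"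
    "g \<cdot> f = idt C (Dom C f)" "f \<cdot> g = idt C (Cod C f)"
    unfolding is_iso_def by (elim conjE bexE)
  then show thesis using that[of g] by (simp add: in_hom)
qed

text \<open>A subobject that contains both the kernel and the section is again a point over
  \<open>Y\<close> with the same kernel, so the split short five lemma applies to its
  inclusion.\<close>

lemma point_mono_iso:
  assumes "is_point C E Y p s" "is_kernel C p k" "is_mono C m" "m \<in> hom C M E"
    and "k1 \<in> hom C (Dom C k) M" "m \<cdot> k1 = k" "s1 \<in> hom C Y M" "m \<cdot> s1 = s"
  shows "is_iso C m"
proof -
  note P = is_pointD[OF assms(1)] and K = is_kernelD[OF assms(2)]
  have m: "m \<in> Arr C" "Dom C m = M" "Cod C m = E" using assms(4) by (simp_all add: in_hom)
  have k1: "k1 \<in> Arr C" "Dom C k1 = Dom C k" "Cod C k1 = M" using assms(5) by (simp_all add: in_hom)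
  have s1: "s1 \<in> Arr C" "Dom C s1 = Y" "Cod C s1 = M" using assms(7) by (simp_all add: in_hom)
  have "is_point C M Y (p \<cdot> m) s1"
    using P m s1 assms(8) by (simp add: is_point_def in_hom)
  moreover have "is_kernel C (p \<cdot> m) k1"
  proof (rule is_kernelI)
    show "is_mono C k1"
      using mono_right_factor[of m k1] kernel_mono[OF assms(2)] assms(6) m k1 by simp
  next
    fix u assume u: "u \<in> Arr C" "Cod C u = Dom C (p \<cdot> m)"
      "(p \<cdot> m) \<cdot> u = zero_arr C (Dom C u) (Cod C (p \<cdot> m))"
    then obtain h where h: "h \<in> Arr C" "Dom C h = Dom C u" "Cod C h = Dom C k" "k \<cdot> h = m \<cdot> u"
      using kernel_lift[OF assms(2), of "m \<cdot> u"] P m by auto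
    have "m \<cdot> (k1 \<cdot> h) = m \<cdot> u"
      using reassoc[OF assms(6), of h] h m k1 by simp
    then have "k1 \<cdot> h = u"
      by (rule monoD[OF assms(3)]) (use h m k1 u P in simp_all)
    then show "\<exists>h. h \<in> hom C (Dom C u) (Dom C k1) \<and> k1 \<cdot> h = u"
      using h k1 by (intro exI[of _ h]) (simp add: in_hom)
  qed (use P K m k1 assms(6) in simp_all)
  ultimately show ?thesis
    using split_short_five[of M Y "p \<cdot> m" s1 E p s m k1] assms by simp
qed

text \<open>The equalizer of \<open>u\<close> and \<open>v\<close> is a subobject containing the
  kernel and the section, hence everything.\<close>

lemma point_epi:
  assumes "is_point C E Y p s" "is_kernel C p k" "u \<in> hom C E D" "v \<in> hom C E D"
    "u \<cdot> k = v \<cdot> k" "u \<cdot> s = v \<cdot> s"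
  shows "u = v"
proof -
  note P = is_pointD[OF assms(1)] and K = is_kernelD[OF assms(2)]
  obtain e where e: "e \<in> Arr C" "Cod C e = E" "u \<cdot> e = v \<cdot> e" "is_mono C e"
    "\<And>w. w \<in> Arr C \<Longrightarrow> Cod C w = E \<Longrightarrow> u \<cdot> w = v \<cdot> w \<Longrightarrow> \<exists>h\<in>hom C (Dom C w) (Dom C e). e \<cdot> h = w"
    using equalizer_ex[OF assms(3,4)] by metis
  obtain k1 where k1: "k1 \<in> hom C (Dom C k) (Dom C e)" "e \<cdot> k1 = k"
    using e(5)[of k] K P assms(5) by auto
  obtain s1 where s1: "s1 \<in> hom C Y (Dom C e)" "e \<cdot> s1 = s"
    using e(5)[of s] P assms(6) by auto
  have "is_iso C e"
    by (rule point_mono_iso[OF assms(1,2) e(4) _ k1 s1]) (use e(1,2) in \<open>simp add: in_hom\<close>)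
  then obtain g where g: "g \<in> Arr C" "Dom C g = E" "Cod C g = Dom C e" "e \<cdot> g = idt C E"
    using iso_inverse e(2) by metis
  have "u \<cdot> (e \<cdot> g) = v \<cdot> (e \<cdot> g)"
    using reassoc[OF e(3), of g] assms(3,4) e(1,2) g by (simp add: in_hom)
  then show ?thesis using g(4) assms(3,4) by (simp add: in_hom)
qed

text \<open>The pullback of \<open>m\<close> along \<open>h\<close> is a subobject of
  \<open>E\<close> containing the kernel and the section, hence everything. This is how membership
  in a subobject, in particular in a relation, is tested on the kernel and the section only.\<close>

lemma point_factor:
  assumes "is_point C E Y p s" "is_kernel C p k" "h \<in> hom C E D" "is_mono C m" "m \<in> hom C M D"
    and "a \<in> hom C (Dom C k) M" "h \<cdot> k = m \<cdot> a" "b \<in> hom C Y M" "h \<cdot> s = m \<cdot> b"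
  obtains t where "t \<in> hom C E M" "h = m \<cdot> t"
proof -
  note P = is_pointD[OF assms(1)] and K = is_kernelD[OF assms(2)]
  have ar: "h \<in> Arr C" "Dom C h = E" "Cod C h = D" "m \<in> Arr C" "Dom C m = M" "Cod C m = D"
    "a \<in> Arr C" "Dom C a = Dom C k" "Cod C a = M" "b \<in> Arr C" "Dom C b = Y" "Cod C b = M"
    using assms by (simp_all add: in_hom)
  obtain x n where pb: "is_pullback C m h x n"
    using pullback_ex[of m h] ar by auto
  note N = is_pullbackD[OF pb]
  have "is_mono C n"
  proof (rule monoI)
    fix u v assume uv: "u \<in> Arr C" "v \<in> Arr C" "Dom C u = Dom C v" "Cod C u = Dom C n"
      "Cod C v = Dom C n" "n \<cdot> u = n \<cdot> v"
    have "m \<cdot> (x \<cdot> u) = m \<cdot> (x \<cdot> v)"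
      using reassoc[OF N(9), of u] reassoc[OF N(9), of v] uv N(1-8) by simp
    then have "x \<cdot> u = x \<cdot> v"
      by (rule monoD[OF assms(4)]) (use uv N(1-8) in simp_all)
    then show "u = v"
      by (intro pullback_ext[OF pb, of u v]) (use uv N(1-8) in simp_all)
  qed (rule N)
  moreover obtain k1 where k1: "k1 \<in> Arr C" "Dom C k1 = Dom C k" "Cod C k1 = Dom C n" "n \<cdot> k1 = k"
    using pullback_lift[OF pb, of a k] ar K P assms(7) by auto
  moreover obtain s1 where s1: "s1 \<in> Arr C" "Dom C s1 = Y" "Cod C s1 = Dom C n" "n \<cdot> s1 = s"
    using pullback_lift[OF pb, of b s] ar P assms(9) by auto
  ultimately have "is_iso C n"
    using N ar by (intro point_mono_iso[OF assms(1,2), of n "Dom C n" k1 s1]) (simp_all add: in_hom)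
  then obtain g where g: "g \<in> Arr C" "Dom C g = E" "Cod C g = Dom C n" "n \<cdot> g = idt C E"
    using iso_inverse N ar by metis
  have "m \<cdot> (x \<cdot> g) = h \<cdot> (n \<cdot> g)"
    using reassoc[OF N(9), of g] N(1-8) g(1-3) by simp
  then show thesis
    using that[of "x \<cdot> g"] N(1-8) g ar by (simp add: in_hom)
qed

section \<open>Regular epimorphisms and relations\<close>

lemma regular: "regular_category C"
  using Barr_exact by (simp add: Barr_exact_def)

lemma regular_epi_Arr: "is_regular_epi C e \<Longrightarrow> e \<in> Arr C"
  by (auto simp: is_regular_epi_def dest: is_coequalizerD)

text \<open>Substitute for choosing a preimage: regular epimorphisms are stable under pullback, so a
  generalized element \<open>u\<close> lifts along \<open>e\<close> once it is restricted to a cover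
  \<open>c\<close>.\<close>

lemma regular_epi_cover:
  assumes "is_regular_epi C e" "u \<in> Arr C" "Cod C u = Cod C e"
  obtains c a where "is_regular_epi C c" "c \<in> Arr C" "a \<in> Arr C" "Dom C c = Dom C a"
    "Cod C c = Dom C u" "Cod C a = Dom C e" "e \<cdot> a = u \<cdot> c"
proof -
  have e: "e \<in> Arr C" by (rule regular_epi_Arr) fact
  obtain a c where pb: "is_pullback C e u a c"
    using pullback_ex[of e u] e assms by auto
  then have "is_regular_epi C c"
    using regular assms(1) unfolding regular_category_def by blast
  then show thesis using that[of c a] is_pullbackD[OF pb] by simp
qed

text \<open>The diagonal of a square between a regular epimorphism and a monomorphism. It brings a
  factorization through \<open>m\<close> found on a cover back to the base.\<close>

lemma regular_epi_mono_factor: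
  assumes "is_regular_epi C c" "is_mono C m" "u \<in> hom C (Cod C c) Y" "m \<in> hom C M Y"
    "w \<in> hom C (Dom C c) M" "u \<cdot> c = m \<cdot> w"
  obtains z where "z \<in> hom C (Cod C c) M" "u = m \<cdot> z"
proof -
  obtain f g where q: "is_coequalizer C f g c" using assms(1) by (auto simp: is_regular_epi_def)
  note Q = is_coequalizerD[OF q]
  have ar: "u \<in> Arr C" "Dom C u = Cod C c" "Cod C u = Y" "m \<in> Arr C" "Dom C m = M" "Cod C m = Y"
    "w \<in> Arr C" "Dom C w = Dom C c" "Cod C w = M"
    using assms by (simp_all add: in_hom)
  have "(m \<cdot> w) \<cdot> f = (m \<cdot> w) \<cdot> g" unfolding assms(6)[symmetric] using Q ar by simp
  then have "m \<cdot> (w \<cdot> f) = m \<cdot> (w \<cdot> g)" using Q ar by simp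
  then have "w \<cdot> f = w \<cdot> g"
    by (rule monoD[OF assms(2)]) (use Q ar in simp_all)
  then obtain z where z: "z \<in> Arr C" "Dom C z = Cod C c" "Cod C z = Cod C w" "z \<cdot> c = w"
    using coequalizer_desc[OF q, of w] ar by metis
  have "u = m \<cdot> z"
    by (rule regular_epi_cancel[OF assms(1)]) (use z ar Q assms(6) in simp_all)
  then show thesis using that[of z] z ar by (simp add: in_hom)
qed

text \<open>Here \<open>e\<close> is the coequalizer of the kernel pair of \<open>f\<close>. If
  \<open>m\<close> identifies two elements, both are lifted along \<open>e\<close> on a common
  cover; the lifts have the same image under \<open>f\<close>, so they form an element of the kernel
  pair and \<open>e\<close> identifies them.\<close>

lemma image_factorization:
  assumes "f \<in> hom C X Y"
  obtains e m where "is_regular_epi C e" "is_mono C m" "e \<in> hom C X (Cod C e)"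
    "m \<in> hom C (Cod C e) Y" "m \<cdot> e = f"
proof -
  have f: "f \<in> Arr C" "Dom C f = X" "Cod C f = Y" using assms by (simp_all add: in_hom)
  obtain p q where pb: "is_pullback C f f p q" using pullback_ex[of f f] f by auto
  then obtain e where coeq: "is_coequalizer C p q e"
    using regular unfolding regular_category_def is_kernel_pair_def by blast
  note N = is_pullbackD[OF pb] and Q = is_coequalizerD[OF coeq]
  have e: "is_regular_epi C e" using coeq by (auto simp: is_regular_epi_def)
  obtain m where m: "m \<in> Arr C" "Dom C m = Cod C e" "Cod C m = Y" "m \<cdot> e = f"
    using coequalizer_desc[OF coeq f(1)] N Q f by metis
  have De: "Dom C e = X" using N Q f by metis
  have "is_mono C m"
  proof (rule monoI)
    fix u v assume uv: "u \<in> Arr C" "v \<in> Arr C" "Dom C u = Dom C v" "Cod C u = Dom C m"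
      "Cod C v = Dom C m" "m \<cdot> u = m \<cdot> v"
    obtain c a where c: "is_regular_epi C c" "c \<in> Arr C" "a \<in> Arr C" "Dom C c = Dom C a"
      "Cod C c = Dom C u" "Cod C a = Dom C e" "e \<cdot> a = u \<cdot> c"
      using regular_epi_cover[OF e, of u] uv m by metis
    have vc: "v \<cdot> c \<in> Arr C" "Cod C (v \<cdot> c) = Cod C e" using uv m c by simp_all
    \<comment> \<open>The second cover is taken over the domain of the first, so that both lifts,
      \<open>a \<cdot> c'\<close> and \<open>a'\<close>, live on the same object.\<close>
    obtain c' a' where c': "is_regular_epi C c'" "c' \<in> Arr C" "a' \<in> Arr C" "Dom C c' = Dom C a'"
      "Cod C c' = Dom C (v \<cdot> c)" "Cod C a' = Dom C e" "e \<cdot> a' = (v \<cdot> c) \<cdot> c'"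
      using regular_epi_cover[OF e vc] by metis
    have "Cod C c' = Dom C a" using c' c uv by simp
    note ar = this Q(3) De m(1-3) c(2-6) c'(2-4,6) uv(1-5)
    have "f \<cdot> (a \<cdot> c') = m \<cdot> (e \<cdot> (a \<cdot> c'))" using ar by (simp add: m(4)[symmetric])
    also have "\<dots> = m \<cdot> (u \<cdot> (c \<cdot> c'))" using reassoc[OF c(7), of c'] ar by simp
    also have "\<dots> = m \<cdot> (v \<cdot> (c \<cdot> c'))" using reassoc[OF uv(6), of "c \<cdot> c'"] ar by simp
    also have "\<dots> = m \<cdot> (e \<cdot> a')" using c'(7) ar by simp
    also have "\<dots> = f \<cdot> a'" using ar by (simp add: m(4)[symmetric])
    finally obtain h where h: "h \<in> Arr C" "Dom C h = Dom C a'" "Cod C h = Dom C q"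
      "p \<cdot> h = a \<cdot> c'" "q \<cdot> h = a'"
      using pullback_lift[OF pb, of "a \<cdot> c'" a'] ar f by auto
    have "e \<cdot> (p \<cdot> h) = e \<cdot> (q \<cdot> h)"
      using reassoc[OF Q(7), of h] Q(1-6) N h(1-3) by simp
    then have "(u \<cdot> c) \<cdot> c' = (v \<cdot> c) \<cdot> c'"
      using h c'(7) reassoc[OF c(7), of c'] ar by simp
    then have "u \<cdot> c = v \<cdot> c"
      by (rule regular_epi_cancel[OF c'(1)]) (use ar c' in simp_all)
    then show "u = v"
      by (rule regular_epi_cancel[OF c(1)]) (use ar c in simp_all)
  qed (rule m)
  then show thesis using that[of e m] e m Q De by (simp add: in_hom)
qed

text \<open>Every relation in a protomodular category is difunctional: on the object of triples
  \<open>(r, r', r'')\<close> with \<open>d1 r = d1 r'\<close> and \<open>d0 r' = d0 r''\<close>, projecting to \<open>(r', r'')\<close> with section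
  \<open>r := r'\<close>, the pair \<open>(d0 r, d1 r'')\<close> lies in the relation on the section and on the kernel.\<close>

lemma relation_difunctional:
  assumes d: "d0 \<in> hom C R X" "d1 \<in> hom C R X" and mono: "is_mono C (pairing C d0 d1)"
    and r: "r \<in> hom C W R" "r' \<in> hom C W R" "r'' \<in> hom C W R"
    and eq: "d1 \<cdot> r = d1 \<cdot> r'" "d0 \<cdot> r' = d0 \<cdot> r''"
  obtains \<rho> where "\<rho> \<in> hom C W R" "d0 \<cdot> \<rho> = d0 \<cdot> r" "d1 \<cdot> \<rho> = d1 \<cdot> r''"
proof -
  have ar: "d0 \<in> Arr C" "Dom C d0 = R" "Cod C d0 = X" "d1 \<in> Arr C" "Dom C d1 = R" "Cod C d1 = X"
    "r \<in> Arr C" "Dom C r = W" "Cod C r = R" "r' \<in> Arr C" "Dom C r' = W" "Cod C r' = R"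
    "r'' \<in> Arr C" "Dom C r'' = W" "Cod C r'' = R" "X \<in> Obj C"
    using d r by (auto simp: in_hom)
  obtain q1 q2 where pbQ: "is_pullback C d0 d0 q1 q2" using pullback_ex[of d0 d0] ar by auto
  note Q = is_pullbackD[OF pbQ]
  let ?Q = "Dom C q2"
  have q: "q1 \<in> Arr C" "Dom C q1 = ?Q" "Cod C q1 = R" "q2 \<in> Arr C" "Cod C q2 = R"
    using Q ar by simp_all
  obtain z1 z2 where pbZ: "is_pullback C d1 (d1 \<cdot> q1) z1 z2"
    using pullback_ex[of d1 "d1 \<cdot> q1"] ar q by auto
  note Z = is_pullbackD[OF pbZ]
  let ?Z = "Dom C z2"
  have z: "z1 \<in> Arr C" "Dom C z1 = ?Z" "Cod C z1 = R" "z2 \<in> Arr C" "Cod C z2 = ?Q"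
    using Z ar q by simp_all
  have zeq: "d1 \<cdot> z1 = d1 \<cdot> (q1 \<cdot> z2)" using Z(9) z q ar by simp
  obtain t where t: "t \<in> Arr C" "Dom C t = ?Q" "Cod C t = ?Z" "z1 \<cdot> t = q1" "z2 \<cdot> t = idt C ?Q"
    using pullback_lift[OF pbZ, of q1 "idt C ?Q"] q ar by auto
  have point: "is_point C ?Z ?Q z2 t" using t z by (simp add: is_point_def in_hom)
  obtain \<kappa> where \<kappa>: "is_kernel C z2 \<kappa>" using is_kernel_kernel[OF z(4)] by blast
  note K = is_kernelD[OF \<kappa>]
  have z2\<kappa>: "z2 \<cdot> \<kappa> = zero_arr C (Dom C \<kappa>) ?Q" using K z by simp
  define h where "h = pairing C (d0 \<cdot> z1) (d1 \<cdot> (q2 \<cdot> z2))"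
  \<comment> \<open>On the kernel \<open>r'\<close> and \<open>r''\<close> vanish, so
    \<open>d1 r = d1 r'\<close> vanishes too and the pair \<open>(d0 r, d1 r'')\<close> is
    \<open>(d0 r, d1 r)\<close>, represented by \<open>r\<close>. On the section
    \<open>r = r'\<close>, and \<open>d0 r' = d0 r''\<close> makes the pair
    \<open>(d0 r'', d1 r'')\<close>, represented by \<open>r''\<close>.\<close>
  have "d1 \<cdot> (z1 \<cdot> \<kappa>) = zero_arr C (Dom C \<kappa>) X"
    using reassoc[OF zeq, of \<kappa>] K(1-3) z q ar z2\<kappa> by simp
  then have "h \<cdot> \<kappa> = pairing C d0 d1 \<cdot> (z1 \<cdot> \<kappa>)"
    by (intro prod_ext[of X X "h \<cdot> \<kappa>" "pairing C d0 d1 \<cdot> (z1 \<cdot> \<kappa>)"])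
      (use K(1-3) z q ar z2\<kappa> in \<open>simp_all add: h_def\<close>)
  moreover have "h \<cdot> t = pairing C d0 d1 \<cdot> q2"
    by (rule prod_ext[of X X]) (use t z q ar Q(9) in \<open>simp_all add: h_def\<close>)
  ultimately obtain \<tau> where \<tau>: "\<tau> \<in> hom C ?Z R" "h = pairing C d0 d1 \<cdot> \<tau>"
    using K(1-3) z q ar
    by (elim point_factor[OF point \<kappa>, of h "prod_obj C X X" _ R "z1 \<cdot> \<kappa>" q2, OF _ mono, rotated 3])
      (simp_all add: in_hom h_def)
  have \<tau>': "\<tau> \<in> Arr C" "Dom C \<tau> = ?Z" "Cod C \<tau> = R" using \<tau>(1) by (simp_all add: in_hom)
  obtain w where w: "w \<in> Arr C" "Dom C w = W" "Cod C w = ?Q" "q1 \<cdot> w = r'" "q2 \<cdot> w = r''"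
    using pullback_lift[OF pbQ, of r' r''] ar eq(2) by auto
  obtain \<omega> where \<omega>: "\<omega> \<in> Arr C" "Dom C \<omega> = W" "Cod C \<omega> = ?Z" "z1 \<cdot> \<omega> = r" "z2 \<cdot> \<omega> = w"
    using pullback_lift[OF pbZ, of r w] ar eq(1) w q by auto
  have "d0 \<cdot> \<tau> = proj1 C X X \<cdot> h" "d1 \<cdot> \<tau> = proj2 C X X \<cdot> h"
    unfolding \<tau>(2) using \<tau>' ar by simp_all
  then have "d0 \<cdot> \<tau> = d0 \<cdot> z1" "d1 \<cdot> \<tau> = d1 \<cdot> (q2 \<cdot> z2)"
    unfolding h_def using z q ar by simp_all
  from reassoc[OF this(1), of \<omega>] reassoc[OF this(2), of \<omega>]
  have "d0 \<cdot> (\<tau> \<cdot> \<omega>) = d0 \<cdot> r" "d1 \<cdot> (\<tau> \<cdot> \<omega>) = d1 \<cdot> r''"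
    using \<tau>' \<omega> ar z q w by simp_all
  then show thesis using that[of "\<tau> \<cdot> \<omega>"] \<tau>' \<omega> by (simp add: in_hom)
qed

text \<open>The Mal'tsev argument. For symmetry, difunctionality is applied to the pairs
  \<open>(b, b)\<close>, \<open>(a, b)\<close>, \<open>(a, a)\<close>, and gives
  \<open>(b, a)\<close>; for transitivity, to \<open>(a, b)\<close>, \<open>(b, b)\<close>,
  \<open>(b, c)\<close>, and gives \<open>(a, c)\<close>. The diagonal pairs come from the section
  \<open>s\<close>.\<close>

lemma reflexive_relation_equivalence:
  assumes d: "d0 \<in> hom C R X" "d1 \<in> hom C R X" and mono: "is_mono C (pairing C d0 d1)"
    and s: "s \<in> hom C X R" "d0 \<cdot> s = idt C X" "d1 \<cdot> s = idt C X"
  shows "is_equivalence_relation C R X d0 d1"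
  unfolding is_equivalence_relation_def
proof (intro conjI allI ballI impI)
  have ar: "d0 \<in> Arr C" "Dom C d0 = R" "Cod C d0 = X" "d1 \<in> Arr C" "Dom C d1 = R" "Cod C d1 = X"
    "s \<in> Arr C" "Dom C s = X" "Cod C s = R" "R \<in> Obj C" "X \<in> Obj C"
    using d s by (auto simp: in_hom)
  have ss: "d0 \<cdot> (s \<cdot> x) = x" "d1 \<cdot> (s \<cdot> x) = x" if "x \<in> Arr C" "Cod C x = X" for x
    using reassoc[OF s(2), of x] reassoc[OF s(3), of x] ar that by simp_all
  show "d0 \<in> hom C R X" "d1 \<in> hom C R X" by fact+
  show "\<exists>d\<in>hom C X R. d0 \<cdot> d = idt C X \<and> d1 \<cdot> d = idt C X" using s by blast
  {
    fix Z u v assume uv: "u \<in> hom C Z R" "v \<in> hom C Z R" "d0 \<cdot> u = d0 \<cdot> v \<and> d1 \<cdot> u = d1 \<cdot> v"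
    have "pairing C d0 d1 \<cdot> u = pairing C d0 d1 \<cdot> v"
      by (rule prod_ext[of X X]) (use uv ar in \<open>simp_all add: in_hom\<close>)
    then show "u = v"
      by (rule monoD[OF mono]) (use uv ar in \<open>simp_all add: in_hom\<close>)
  }
  show "\<exists>s\<in>hom C R R. d0 \<cdot> s = d1 \<and> d1 \<cdot> s = d0"
    by (rule relation_difunctional[OF d mono, of "s \<cdot> d1" R "idt C R" "s \<cdot> d0"])
      (use ar ss in \<open>auto simp: in_hom\<close>)
  {
    fix P p1 p2 assume P: "p1 \<in> hom C P R \<and> p2 \<in> hom C P R \<and> is_pullback C d1 d0 p1 p2"
    then have eq: "d1 \<cdot> p1 = d0 \<cdot> p2" by (blast dest: is_pullbackD)
    show "\<exists>t\<in>hom C P R. d0 \<cdot> t = d0 \<cdot> p1 \<and> d1 \<cdot> t = d1 \<cdot> p2"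
      by (rule relation_difunctional[OF d mono, of p1 P "s \<cdot> (d1 \<cdot> p1)" p2])
        (use P eq ar ss in \<open>auto simp: in_hom\<close>)
  }
qed

text \<open>The image of the graph in \<open>X \<times> X\<close> is a reflexive relation, hence an
  equivalence relation, hence by exactness the kernel pair of some \<open>f\<close>. A pair
  identified by \<open>f\<close> lies in the image, and an element of the image lifts to
  \<open>S\<close> only on a cover.\<close>

lemma reflexive_graph_kernel_pair:
  assumes d: "d0 \<in> hom C S X" "d1 \<in> hom C S X"
    and s: "s \<in> hom C X S" "d0 \<cdot> s = idt C X" "d1 \<cdot> s = idt C X"
  obtains f where "f \<in> Arr C" "Dom C f = X" "f \<cdot> d0 = f \<cdot> d1"
    "\<And>W u v. \<lbrakk>u \<in> hom C W X; v \<in> hom C W X; f \<cdot> u = f \<cdot> v\<rbrakk> \<Longrightarrow>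
      \<exists>c n. is_regular_epi C c \<and> c \<in> Arr C \<and> Cod C c = W \<and> n \<in> hom C (Dom C c) S \<and>
        d0 \<cdot> n = u \<cdot> c \<and> d1 \<cdot> n = v \<cdot> c"
proof -
  have ar: "d0 \<in> Arr C" "Dom C d0 = S" "Cod C d0 = X" "d1 \<in> Arr C" "Dom C d1 = S" "Cod C d1 = X"
    "s \<in> Arr C" "Dom C s = X" "Cod C s = S" "X \<in> Obj C"
    using d s by (auto simp: in_hom)
  have "pairing C d0 d1 \<in> hom C S (prod_obj C X X)" using ar by (simp add: in_hom)
  from image_factorization[OF this] obtain e m where e: "is_regular_epi C e" and m: "is_mono C m"
    and "e \<in> hom C S (Cod C e)" "m \<in> hom C (Cod C e) (prod_obj C X X)" and me: "m \<cdot> e = pairing C d0 d1"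
    by metis
  then have em: "e \<in> Arr C" "Dom C e = S" "m \<in> Arr C" "Dom C m = Cod C e" "Cod C m = prod_obj C X X"
    by (simp_all add: in_hom)
  define r0 r1 where "r0 = proj1 C X X \<cdot> m" and "r1 = proj2 C X X \<cdot> m"
  have r: "r0 \<in> Arr C" "Dom C r0 = Cod C e" "Cod C r0 = X" "r1 \<in> Arr C" "Dom C r1 = Cod C e" "Cod C r1 = X"
    using em ar by (simp_all add: r0_def r1_def)
  have re: "r0 \<cdot> e = d0" "r1 \<cdot> e = d1"
    using em ar by (simp_all add: r0_def r1_def me)
  have "pairing C r0 r1 = m"
    by (rule prod_ext[of X X]) (use em ar r in \<open>simp_all add: r0_def r1_def\<close>)
  then have "is_equivalence_relation C (Cod C e) X r0 r1"
    using m r em ar s(2,3) reassoc[OF re(1), of s] reassoc[OF re(2), of s]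
    by (intro reflexive_relation_equivalence[where s = "e \<cdot> s"]) (simp_all add: in_hom)
  then obtain f where "is_kernel_pair C f r0 r1"
    using Barr_exact unfolding Barr_exact_def by blast
  then have pb: "is_pullback C f f r0 r1" by (simp add: is_kernel_pair_def)
  note F = is_pullbackD[OF pb]
  have "f \<cdot> (r0 \<cdot> e) = f \<cdot> (r1 \<cdot> e)" using reassoc[OF F(9), of e] F(1-8) em r by simp
  then have fd: "f \<cdot> d0 = f \<cdot> d1" by (simp add: re)
  have cov: "\<exists>c n. is_regular_epi C c \<and> c \<in> Arr C \<and> Cod C c = W \<and> n \<in> hom C (Dom C c) S \<and>
        d0 \<cdot> n = u \<cdot> c \<and> d1 \<cdot> n = v \<cdot> c"
    if uv: "u \<in> hom C W X" "v \<in> hom C W X" "f \<cdot> u = f \<cdot> v" for W u v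
  proof -
    obtain h where h: "h \<in> Arr C" "Dom C h = W" "Cod C h = Cod C e" "r0 \<cdot> h = u" "r1 \<cdot> h = v"
      using pullback_lift[OF pb, of u v] uv F r by (auto simp: in_hom)
    obtain c a where c: "is_regular_epi C c" "c \<in> Arr C" "a \<in> Arr C" "Dom C c = Dom C a"
      "Cod C c = Dom C h" "Cod C a = Dom C e" "e \<cdot> a = h \<cdot> c"
      using regular_epi_cover[OF e h(1,3)] by metis
    have "d0 \<cdot> a = r0 \<cdot> (e \<cdot> a)" "d1 \<cdot> a = r1 \<cdot> (e \<cdot> a)"
      using c em r by (simp_all add: re[symmetric])
    then have "d0 \<cdot> a = u \<cdot> c" "d1 \<cdot> a = v \<cdot> c"
      using reassoc[OF h(4), of c] reassoc[OF h(5), of c] c h(1-3) r by simp_all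
    then show ?thesis using c h em by (intro exI[of _ c] exI[of _ a]) (simp add: in_hom)
  qed
  show thesis
    by (rule that[OF F(1) _ fd cov]) (use F r in simp_all)
qed

section \<open>Cosmash products and the functor \<open>T\<close>\<close>

text \<open>\<open>cosmash_map\<close>, \<open>j_arr\<close>, \<open>eta\<close>,
  \<open>psi0\<close> and \<open>conj_T\<close> are all definite descriptions of lifts through a
  kernel; for each of them only the vanishing of a composite remains to be checked.\<close>

lemma kernel_THE:
  assumes "is_kernel C f k" "u \<in> hom C W (Dom C f)" "f \<cdot> u = zero_arr C W (Cod C f)"
    and "h = (THE h. h \<in> hom C W (Dom C k) \<and> k \<cdot> h = u)"
  shows "h \<in> hom C W (Dom C k)" "k \<cdot> h = u"
proof -
  have u: "u \<in> Arr C" "Cod C u = Dom C f" "Dom C u = W" using assms(2) by (simp_all add: in_hom)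
  have "\<exists>!h. h \<in> hom C W (Dom C k) \<and> k \<cdot> h = u"
    using kernel_ex1[OF assms(1) u(1,2)] assms(3) u(3) by simp
  from theI'[OF this] show "h \<in> hom C W (Dom C k)" "k \<cdot> h = u"
    unfolding assms(4) by simp_all
qed

lemma sum_to_prod_simps [simp]:
  assumes "A \<in> Obj C" "G \<in> Obj C"
  shows "sum_to_prod C A G \<in> Arr C" "Dom C (sum_to_prod C A G) = coprod_obj C A G"
    "Cod C (sum_to_prod C A G) = prod_obj C A G"
    "proj1 C A G \<cdot> sum_to_prod C A G = copairing C (idt C A) (zero_arr C G A)"
    "proj2 C A G \<cdot> sum_to_prod C A G = r_arr C A G"
  using assms by (simp_all add: sum_to_prod_def r_arr_def Comp_copairing)

lemma r_arr_simps [simp]: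
  assumes "A \<in> Obj C" "G \<in> Obj C"
  shows "r_arr C A G \<in> Arr C" "Dom C (r_arr C A G) = coprod_obj C A G" "Cod C (r_arr C A G) = G"
    "r_arr C A G \<cdot> inj1 C A G = zero_arr C A G" "r_arr C A G \<cdot> inj2 C A G = idt C G"
  using assms by (simp_all add: r_arr_def)

lemma is_kernel_iota:
  "A \<in> Obj C \<Longrightarrow> G \<in> Obj C \<Longrightarrow> is_kernel C (sum_to_prod C A G) (iota C A G)"
  by (simp add: iota_def is_kernel_kernel)

lemma iota_simps [simp]:
  assumes "A \<in> Obj C" "G \<in> Obj C"
  shows "iota C A G \<in> Arr C" "Dom C (iota C A G) = cosmash C A G"
    "Cod C (iota C A G) = coprod_obj C A G" "cosmash C A G \<in> Obj C"
    "sum_to_prod C A G \<cdot> iota C A G = zero_arr C (cosmash C A G) (prod_obj C A G)"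
  using is_kernelD[OF is_kernel_iota[OF assms]] assms by (simp_all add: cosmash_def)

lemma iota_zero [simp]:
  assumes "A \<in> Obj C" "G \<in> Obj C"
  shows "copairing C (idt C A) (zero_arr C G A) \<cdot> iota C A G = zero_arr C (cosmash C A G) A"
    "r_arr C A G \<cdot> iota C A G = zero_arr C (cosmash C A G) G"
  using reassoc[OF sum_to_prod_simps(4), of A G "iota C A G"]
    reassoc[OF sum_to_prod_simps(5), of A G "iota C A G"] assms by simp_all

text \<open>A map that kills one summand of \<open>A + G\<close> factors through a projection of
  \<open>A \<times> G\<close>, and \<open>iota\<close> is the kernel of the comparison with that
  product.\<close>

lemma copairing_zero_iota:
  assumes "A \<in> Obj C" "G \<in> Obj C"
  shows "f \<in> hom C A E \<Longrightarrow> copairing C f (zero_arr C G E) \<cdot> iota C A G = zero_arr C (cosmash C A G) E"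
    "g \<in> hom C G E \<Longrightarrow> copairing C (zero_arr C A E) g \<cdot> iota C A G = zero_arr C (cosmash C A G) E"
proof -
  assume f: "f \<in> hom C A E"
  then have "copairing C f (zero_arr C G E) = f \<cdot> copairing C (idt C A) (zero_arr C G A)"
    using assms by (auto simp: in_hom Comp_copairing)
  then show "copairing C f (zero_arr C G E) \<cdot> iota C A G = zero_arr C (cosmash C A G) E"
    using f assms by (auto simp: in_hom)
next
  assume g: "g \<in> hom C G E"
  then have "copairing C (zero_arr C A E) g = g \<cdot> r_arr C A G"
    using assms by (auto simp: in_hom r_arr_def Comp_copairing)
  then show "copairing C (zero_arr C A E) g \<cdot> iota C A G = zero_arr C (cosmash C A G) E"
    using g assms by (auto simp: in_hom)
qed

lemma sum_to_prod_zeroI: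
  assumes "A \<in> Obj C" "G \<in> Obj C" "u \<in> hom C W (coprod_obj C A G)"
    "copairing C (idt C A) (zero_arr C G A) \<cdot> u = zero_arr C W A" "r_arr C A G \<cdot> u = zero_arr C W G"
  shows "sum_to_prod C A G \<cdot> u = zero_arr C W (prod_obj C A G)"
proof -
  have u: "u \<in> Arr C" "Dom C u = W" "Cod C u = coprod_obj C A G" "W \<in> Obj C"
    using assms(3) by (auto simp: in_hom)
  show ?thesis
    by (rule prod_ext[of A G])
      (use reassoc[OF sum_to_prod_simps(4), of A G u] reassoc[OF sum_to_prod_simps(5), of A G u]
        u assms in simp_all)
qed

lemma cosmash_map_hom:
  assumes "a \<in> Arr C" "g \<in> Arr C"
  shows "cosmash_map C a g \<in> hom C (cosmash C (Dom C a) (Dom C g)) (cosmash C (Cod C a) (Cod C g))"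
    "iota C (Cod C a) (Cod C g) \<cdot> cosmash_map C a g = coprod_map C a g \<cdot> iota C (Dom C a) (Dom C g)"
proof -
  let ?A = "Dom C a" and ?A' = "Cod C a" and ?G = "Dom C g" and ?G' = "Cod C g"
  let ?u = "coprod_map C a g \<cdot> iota C ?A ?G"
  note ker = is_kernel_iota[of ?A' ?G', OF Cod_Obj[OF assms(1)] Cod_Obj[OF assms(2)]]
  have u: "?u \<in> hom C (cosmash C ?A ?G) (coprod_obj C ?A' ?G')"
    using assms by (simp add: in_hom)
  have "copairing C (idt C ?A') (zero_arr C ?G' ?A') \<cdot> coprod_map C a g = copairing C a (zero_arr C ?G ?A')"
    using assms by (simp add: copairing_coprod_map)
  from reassoc[OF this, of "iota C ?A ?G"]
  have 1: "copairing C (idt C ?A') (zero_arr C ?G' ?A') \<cdot> ?u = zero_arr C (cosmash C ?A ?G) ?A'"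
    using assms by (simp add: copairing_zero_iota in_hom)
  have "r_arr C ?A' ?G' \<cdot> coprod_map C a g = copairing C (zero_arr C ?A ?G') g"
    using assms by (simp add: copairing_coprod_map r_arr_def)
  from reassoc[OF this, of "iota C ?A ?G"]
  have 2: "r_arr C ?A' ?G' \<cdot> ?u = zero_arr C (cosmash C ?A ?G) ?G'"
    using assms by (simp add: copairing_zero_iota in_hom)
  have "sum_to_prod C ?A' ?G' \<cdot> ?u = zero_arr C (cosmash C ?A ?G) (prod_obj C ?A' ?G')"
    using assms by (intro sum_to_prod_zeroI[OF _ _ u 1 2]) simp_all
  then show "cosmash_map C a g \<in> hom C (cosmash C ?A ?G) (cosmash C ?A' ?G')"
    "iota C ?A' ?G' \<cdot> cosmash_map C a g = ?u"
    using kernel_THE[OF ker, of ?u "cosmash C ?A ?G" "cosmash_map C a g"] u assms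
    by (simp_all add: cosmash_map_def)
qed

lemma cosmash_map_simps [simp]:
  assumes "a \<in> Arr C" "g \<in> Arr C"
  shows "cosmash_map C a g \<in> Arr C" "Dom C (cosmash_map C a g) = cosmash C (Dom C a) (Dom C g)"
    "Cod C (cosmash_map C a g) = cosmash C (Cod C a) (Cod C g)"
  using cosmash_map_hom(1)[OF assms] by (simp_all add: in_hom)

lemma copairing_cosmash_map:
  assumes "a \<in> hom C A A'" "g \<in> hom C G G'" "u \<in> hom C A' E" "v \<in> hom C G' E"
  shows "copairing C u v \<cdot> (iota C A' G' \<cdot> cosmash_map C a g) = copairing C (u \<cdot> a) (v \<cdot> g) \<cdot> iota C A G"
proof -
  have ar: "a \<in> Arr C" "Dom C a = A" "Cod C a = A'" "g \<in> Arr C" "Dom C g = G" "Cod C g = G'"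
    "u \<in> Arr C" "Dom C u = A'" "Cod C u = E" "v \<in> Arr C" "Dom C v = G'" "Cod C v = E"
    "A \<in> Obj C" "G \<in> Obj C"
    using assms by (auto simp: in_hom)
  have "copairing C u v \<cdot> coprod_map C a g = copairing C (u \<cdot> a) (v \<cdot> g)"
    using ar by (simp add: copairing_coprod_map)
  from reassoc[OF this, of "iota C A G"] show ?thesis
    using ar cosmash_map_hom(2)[of a g] by simp
qed

text \<open>Removes \<open>c2\<close> from the definitions of \<open>psi0\<close> and
  \<open>conj_T\<close>: conjugation of \<open>f\<close> by \<open>g\<close> is
  \<open>[f, g]\<close> restricted along \<open>iota\<close>, the form used in all later
  computations.\<close>

lemma c2_cosmash_map:
  assumes "f \<in> hom C A E" "g \<in> hom C B E"
  shows "c2 C E \<cdot> cosmash_map C f g = copairing C f g \<cdot> iota C A B"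
proof -
  have ar: "f \<in> Arr C" "Dom C f = A" "Cod C f = E" "g \<in> Arr C" "Dom C g = B" "Cod C g = E"
    "E \<in> Obj C"
    using assms by (auto simp: in_hom)
  then show ?thesis
    using copairing_cosmash_map[OF assms, of "idt C E" E "idt C E"]
    by (simp add: c2_def in_hom)
qed

section \<open>The object \<open>TA\<close> as a kernel and as a point over \<open>A\<close>\<close>

lemma is_kernel_k_arr:
  "A \<in> Obj C \<Longrightarrow> G \<in> Obj C \<Longrightarrow> is_kernel C (r_arr C A G) (k_arr C A G)"
  by (simp add: k_arr_def is_kernel_kernel)

lemma k_arr_simps [simp]:
  assumes "A \<in> Obj C" "G \<in> Obj C"
  shows "k_arr C A G \<in> Arr C" "Dom C (k_arr C A G) = T_obj C A G"
    "Cod C (k_arr C A G) = coprod_obj C A G" "T_obj C A G \<in> Obj C"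
    "r_arr C A G \<cdot> k_arr C A G = zero_arr C (T_obj C A G) G"
  using is_kernelD[OF is_kernel_k_arr[OF assms]] assms by (simp_all add: T_obj_def)

lemma k_arr_mono:
  assumes "A \<in> Obj C" "G \<in> Obj C" "k_arr C A G \<cdot> u = k_arr C A G \<cdot> v"
    "u \<in> hom C W (T_obj C A G)" "v \<in> hom C W (T_obj C A G)"
  shows "u = v"
  by (rule monoD[OF kernel_mono[OF is_kernel_k_arr[OF assms(1,2)]] assms(3)])
    (use assms in \<open>simp_all add: in_hom\<close>)

lemma k_arr_lift:
  assumes "A \<in> Obj C" "G \<in> Obj C" "u \<in> hom C W (coprod_obj C A G)"
    "r_arr C A G \<cdot> u = zero_arr C W G"
  obtains h where "h \<in> hom C W (T_obj C A G)" "k_arr C A G \<cdot> h = u"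
  by (rule kernel_lift[OF is_kernel_k_arr[OF assms(1,2)], of u])
    (use assms that in \<open>simp_all add: in_hom\<close>)

lemma j_arr_hom:
  assumes "A \<in> Obj C" "G \<in> Obj C"
  shows "j_arr C A G \<in> hom C (cosmash C A G) (T_obj C A G)" "k_arr C A G \<cdot> j_arr C A G = iota C A G"
  using kernel_THE[OF is_kernel_k_arr[OF assms], of "iota C A G" "cosmash C A G" "j_arr C A G"] assms
  by (simp_all add: in_hom j_arr_def)

lemma eta_hom:
  assumes "A \<in> Obj C" "G \<in> Obj C"
  shows "eta C A G \<in> hom C A (T_obj C A G)" "k_arr C A G \<cdot> eta C A G = inj1 C A G"
  using kernel_THE[OF is_kernel_k_arr[OF assms], of "inj1 C A G" A "eta C A G"] assms
  by (simp_all add: in_hom eta_def)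

lemma j_eta_simps [simp]:
  assumes "A \<in> Obj C" "G \<in> Obj C"
  shows "j_arr C A G \<in> Arr C" "Dom C (j_arr C A G) = cosmash C A G" "Cod C (j_arr C A G) = T_obj C A G"
    "k_arr C A G \<cdot> j_arr C A G = iota C A G"
    "eta C A G \<in> Arr C" "Dom C (eta C A G) = A" "Cod C (eta C A G) = T_obj C A G"
    "k_arr C A G \<cdot> eta C A G = inj1 C A G"
  using j_arr_hom[OF assms] eta_hom[OF assms] by (simp_all add: in_hom)

lemma k_Comp [simp]:
  assumes "A \<in> Obj C" "G \<in> Obj C" "x \<in> Arr C"
  shows "Cod C x = cosmash C A G \<Longrightarrow> k_arr C A G \<cdot> (j_arr C A G \<cdot> x) = iota C A G \<cdot> x"
    "Cod C x = A \<Longrightarrow> k_arr C A G \<cdot> (eta C A G \<cdot> x) = inj1 C A G \<cdot> x"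
  using reassoc[OF j_eta_simps(4), OF assms(1,2), of x] reassoc[OF j_eta_simps(8), OF assms(1,2), of x]
    assms by simp_all

text \<open>The projection \<open>p\<close> is \<open>[1, 0] k\<close>. An element of
  \<open>TA\<close> killed by \<open>p\<close> is killed in \<open>A + G\<close> by
  \<open>[1, 0]\<close> and by \<open>r_arr\<close>, hence by the comparison with
  \<open>A \<times> G\<close>, and therefore comes from \<open>(A|G)\<close>.\<close>

lemma T_point:
  assumes "A \<in> Obj C" "G \<in> Obj C"
  defines "p \<equiv> copairing C (idt C A) (zero_arr C G A) \<cdot> k_arr C A G"
  shows "is_point C (T_obj C A G) A p (eta C A G)" "is_kernel C p (j_arr C A G)"
proof -
  show "is_point C (T_obj C A G) A p (eta C A G)"
    using assms(1,2) by (simp add: p_def is_point_def in_hom)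
  let ?j = "j_arr C A G" and ?k = "k_arr C A G"
  have "is_mono C ?j"
    using mono_right_factor[of ?k ?j] kernel_mono[OF is_kernel_iota[OF assms(1,2)]] assms(1,2) by simp
  moreover have "\<exists>h. h \<in> hom C (Dom C u) (Dom C ?j) \<and> ?j \<cdot> h = u"
    if u: "u \<in> Arr C" "Cod C u = Dom C p" "p \<cdot> u = zero_arr C (Dom C u) (Cod C p)" for u
  proof -
    have Cu: "Cod C u = T_obj C A G" using u(2) assms(1,2) by (simp add: p_def)
    have "r_arr C A G \<cdot> (?k \<cdot> u) = zero_arr C (Dom C u) G"
      using reassoc[OF k_arr_simps(5), of A G u] assms(1,2) u(1) Cu by simp
    then have "sum_to_prod C A G \<cdot> (?k \<cdot> u) = zero_arr C (Dom C u) (prod_obj C A G)"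
      using assms(1,2) u Cu
      by (intro sum_to_prod_zeroI[of A G "?k \<cdot> u" "Dom C u"]) (simp_all add: in_hom p_def)
    then obtain h where h: "h \<in> Arr C" "Dom C h = Dom C u" "Cod C h = cosmash C A G"
      "iota C A G \<cdot> h = ?k \<cdot> u"
      using kernel_lift[OF is_kernel_iota[OF assms(1,2)], of "?k \<cdot> u"] assms(1,2) u(1) Cu by auto
    have "?j \<cdot> h = u"
      by (rule k_arr_mono[OF assms(1,2)]) (use h assms(1,2) u(1) Cu in \<open>simp_all add: in_hom\<close>)
    then show ?thesis using h assms(1,2) by (intro exI[of _ h]) (simp add: in_hom)
  qed
  ultimately show "is_kernel C p ?j"
    using assms(1,2) by (intro is_kernelI) (simp_all add: p_def)
qed

lemma T_ext:
  assumes "A \<in> Obj C" "G \<in> Obj C" "u \<in> hom C (T_obj C A G) D" "v \<in> hom C (T_obj C A G) D"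
    "u \<cdot> j_arr C A G = v \<cdot> j_arr C A G" "u \<cdot> eta C A G = v \<cdot> eta C A G"
  shows "u = v"
  by (rule point_epi[OF T_point[OF assms(1,2)] assms(3-6)])

text \<open>A point is the semidirect product of its kernel with its base: \<open>[k, s]\<close> is the coequalizer
  of \<open>\<iota>\<close> and the conjugation action \<open>\<kappa>\<close>. The coequalizer \<open>Q\<close> is itself a point over \<open>B\<close> with
  kernel \<open>K\<close>, so the split short five lemma identifies it with \<open>E\<close>.\<close>

lemma semidirect_desc:
  assumes pt: "is_point C E B p s" and ker: "is_kernel C p k" and K: "K = Dom C k"
    and \<kappa>: "\<kappa> \<in> hom C (cosmash C K B) K" "k \<cdot> \<kappa> = copairing C k s \<cdot> iota C K B"
    and fg: "f \<in> hom C K D" "g \<in> hom C B D" "f \<cdot> \<kappa> = copairing C f g \<cdot> iota C K B"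
  obtains h where "h \<in> hom C E D" "h \<cdot> k = f" "h \<cdot> s = g"
proof -
  note P = is_pointD[OF pt] and KD = is_kernelD[OF ker]
  have ar: "\<kappa> \<in> Arr C" "Dom C \<kappa> = cosmash C K B" "Cod C \<kappa> = K" "f \<in> Arr C" "Dom C f = K" "Cod C f = D"
    "g \<in> Arr C" "Dom C g = B" "Cod C g = D" "K \<in> Obj C" "B \<in> Obj C" "E \<in> Obj C"
    "k \<in> Arr C" "Dom C k = K" "Cod C k = E"
    using \<kappa> fg P KD K by (auto simp: in_hom)
  have pk: "p \<cdot> k = zero_arr C K B" using KD(4) P(4) ar(14) by simp
  define q where "q = coequalizer C (iota C K B) (inj1 C K B \<cdot> \<kappa>)"
  have coeq: "is_coequalizer C (iota C K B) (inj1 C K B \<cdot> \<kappa>) q"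
    unfolding q_def using ar
    by (intro coequalizer_ex[of _ "cosmash C K B" "coprod_obj C K B"]) (simp_all add: in_hom)
  then have reg: "is_regular_epi C q" by (auto simp: is_regular_epi_def)
  have q: "q \<in> Arr C" "Dom C q = coprod_obj C K B" using is_coequalizerD[OF coeq] ar by simp_all
  have qeq: "q \<cdot> iota C K B = q \<cdot> (inj1 C K B \<cdot> \<kappa>)" by (rule is_coequalizerD[OF coeq])
  let ?Q = "Cod C q"
  define m where "m = q \<cdot> inj1 C K B"
  have m: "m \<in> Arr C" "Dom C m = K" "Cod C m = ?Q" using q ar by (simp_all add: m_def)
  have "r_arr C K B \<cdot> iota C K B = r_arr C K B \<cdot> (inj1 C K B \<cdot> \<kappa>)"
    using reassoc[OF r_arr_simps(4), of K B \<kappa>] ar by simp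
  then obtain pp where pp: "pp \<in> Arr C" "Dom C pp = ?Q" "Cod C pp = B" "pp \<cdot> q = r_arr C K B"
    using coequalizer_desc[OF coeq, of "r_arr C K B"] q ar by auto
  obtain \<epsilon> where \<epsilon>: "\<epsilon> \<in> Arr C" "Dom C \<epsilon> = ?Q" "Cod C \<epsilon> = E" "\<epsilon> \<cdot> q = copairing C k s"
    using coequalizer_desc[OF coeq, of "copairing C k s"] q ar P \<kappa> by auto
  have "p \<cdot> (\<epsilon> \<cdot> q) = pp \<cdot> q"
    using P ar pk by (simp add: \<epsilon>(4) pp(4) Comp_copairing r_arr_def)
  then have p\<epsilon>: "p \<cdot> \<epsilon> = pp"
    by (intro regular_epi_cancel[OF reg, of "p \<cdot> \<epsilon>" pp]) (use P \<epsilon> pp q in simp_all)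
  have \<epsilon>m: "\<epsilon> \<cdot> m = k" and \<epsilon>s: "\<epsilon> \<cdot> (q \<cdot> inj2 C K B) = s"
    using reassoc[OF \<epsilon>(4), of "inj1 C K B"] reassoc[OF \<epsilon>(4), of "inj2 C K B"] \<epsilon>(1-3) q ar P
    by (simp_all add: m_def)
  have mono: "is_mono C m"
    using mono_right_factor[of \<epsilon> m] kernel_mono[OF ker] \<epsilon>(1-3) m \<epsilon>m by simp
  have ppm: "pp \<cdot> m = zero_arr C K B"
    using reassoc[OF pp(4), of "inj1 C K B"] pp(1-3) q ar by (simp add: m_def)
  have pps: "pp \<cdot> (q \<cdot> inj2 C K B) = idt C B"
    using reassoc[OF pp(4), of "inj2 C K B"] pp(1-3) q ar by simp
  have "is_kernel C pp m"
  proof (rule is_kernelI)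
    fix u assume u: "u \<in> Arr C" "Cod C u = Dom C pp" "pp \<cdot> u = zero_arr C (Dom C u) (Cod C pp)"
    obtain c a where c: "is_regular_epi C c" "c \<in> Arr C" "a \<in> Arr C" "Dom C c = Dom C a"
      "Cod C c = Dom C u" "Cod C a = Dom C q" "q \<cdot> a = u \<cdot> c"
      using regular_epi_cover[OF reg u(1)] u(2) pp(2) by metis
    have "r_arr C K B \<cdot> a = pp \<cdot> (u \<cdot> c)"
      using c q pp(1-3) by (simp add: pp(4)[symmetric])
    then have "r_arr C K B \<cdot> a = zero_arr C (Dom C a) B"
      using reassoc[OF u(3), of c] c u(1,2) pp(1-3) ar by simp
    then obtain a' where "a' \<in> hom C (Dom C a) (T_obj C K B)" and ka: "k_arr C K B \<cdot> a' = a"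
      using k_arr_lift[of K B a "Dom C a"] ar c q by (auto simp: in_hom)
    then have a': "a' \<in> Arr C" "Dom C a' = Dom C a" "Cod C a' = T_obj C K B" by (simp_all add: in_hom)
    \<comment> \<open>Elements of \<open>K + B\<close> over zero in \<open>B\<close> are sent by
      \<open>q\<close> into the subobject \<open>m\<close>. As \<open>T_obj C K B\<close> is a
      point, this is tested along \<open>j_arr\<close>, where the coequalizer equation gives
      \<open>m \<cdot> \<kappa>\<close>, and along \<open>eta\<close>, where \<open>q\<close> gives
      \<open>m\<close> itself.\<close>
    obtain t where "t \<in> hom C (T_obj C K B) K" and qk: "q \<cdot> k_arr C K B = m \<cdot> t"
    proof (rule point_factor[OF T_point[OF ar(10,11)] _ mono, of "q \<cdot> k_arr C K B" ?Q K \<kappa> "idt C K"])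
      show "(q \<cdot> k_arr C K B) \<cdot> j_arr C K B = m \<cdot> \<kappa>" using q ar qeq by (simp add: m_def)
      show "(q \<cdot> k_arr C K B) \<cdot> eta C K B = m \<cdot> idt C K" using q ar by (simp add: m_def)
    qed (use q ar m in \<open>simp_all add: in_hom\<close>)
    then have t: "t \<in> Arr C" "Dom C t = T_obj C K B" "Cod C t = K" by (simp_all add: in_hom)
    have "u \<cdot> c = m \<cdot> (t \<cdot> a')"
      using reassoc[OF qk, of a'] ka c(7) q ar a' t m by simp
    then obtain z where "z \<in> hom C (Cod C c) K" "u = m \<cdot> z"
      using regular_epi_mono_factor[OF c(1) mono, of u ?Q K "t \<cdot> a'"] u c a' t m pp
      by (auto simp: in_hom)
    then show "\<exists>h. h \<in> hom C (Dom C u) (Dom C m) \<and> m \<cdot> h = u"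
      using c m by auto
  qed (use pp m mono ppm in simp_all)
  then have "is_iso C \<epsilon>"
    using split_short_five[of ?Q B pp "q \<cdot> inj2 C K B" E p s \<epsilon> m] pt ker pps \<epsilon>s \<epsilon>m p\<epsilon> pp(1-3) \<epsilon>(1-3) q ar
    by (simp add: is_point_def in_hom)
  then obtain \<gamma> where \<gamma>: "\<gamma> \<in> Arr C" "Dom C \<gamma> = E" "Cod C \<gamma> = ?Q" "\<gamma> \<cdot> \<epsilon> = idt C ?Q"
    using iso_inverse \<epsilon>(2,3) by metis
  obtain \<phi> where \<phi>: "\<phi> \<in> Arr C" "Dom C \<phi> = ?Q" "Cod C \<phi> = D" "\<phi> \<cdot> q = copairing C f g"
    using coequalizer_desc[OF coeq, of "copairing C f g"] q ar fg(3) by auto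
  have "\<gamma> \<cdot> k = m" "\<gamma> \<cdot> s = q \<cdot> inj2 C K B"
    using reassoc[OF \<gamma>(4), of m] reassoc[OF \<gamma>(4), of "q \<cdot> inj2 C K B"] \<epsilon>m \<epsilon>s \<epsilon>(1-3) \<gamma>(1-3) m q ar
    by simp_all
  moreover have "\<phi> \<cdot> m = f" "\<phi> \<cdot> (q \<cdot> inj2 C K B) = g"
    using reassoc[OF \<phi>(4), of "inj1 C K B"] reassoc[OF \<phi>(4), of "inj2 C K B"] \<phi>(1-3) q ar
    by (simp_all add: m_def)
  ultimately show thesis
    using that[of "\<phi> \<cdot> \<gamma>"] \<phi>(1-3) \<gamma>(1-3) ar P by (simp add: in_hom)
qed

text \<open>The second equation exhibits \<open>psi0\<close> as the conjugation action of the
  section \<open>eta\<close> on the kernel \<open>j_arr\<close> of the point \<open>TA\<close>. This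
  is the \<kappa> that \<open>semidirect_desc\<close> asks for.\<close>

lemma psi0_hom:
  assumes "A \<in> Obj C" "G \<in> Obj C"
  defines "K \<equiv> cosmash C A G"
  shows "psi0 C A G \<in> hom C (cosmash C K A) K"
    "j_arr C A G \<cdot> psi0 C A G = copairing C (j_arr C A G) (eta C A G) \<cdot> iota C K A"
proof -
  let ?u = "copairing C (iota C A G) (inj1 C A G) \<cdot> iota C K A"
  have K: "K \<in> Obj C" using assms by simp
  have c2: "c2 C (coprod_obj C A G) \<cdot> cosmash_map C (iota C A G) (inj1 C A G) = ?u"
    using assms by (intro c2_cosmash_map) (simp_all add: in_hom)
  have u: "?u \<in> hom C (cosmash C K A) (coprod_obj C A G)"
    using assms(1,2) K by (simp add: in_hom K_def)
  have "copairing C (idt C A) (zero_arr C G A) \<cdot> copairing C (iota C A G) (inj1 C A G) = r_arr C K A"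
    using assms(1,2) by (simp add: Comp_copairing r_arr_def K_def)
  from reassoc[OF this, of "iota C K A"]
  have 1: "copairing C (idt C A) (zero_arr C G A) \<cdot> ?u = zero_arr C (cosmash C K A) A"
    using assms(1,2) K by (simp add: K_def)
  have "r_arr C A G \<cdot> copairing C (iota C A G) (inj1 C A G) = copairing C (zero_arr C K G) (zero_arr C A G)"
    using assms(1,2) by (simp add: Comp_copairing K_def)
  from reassoc[OF this, of "iota C K A"]
  have 2: "r_arr C A G \<cdot> ?u = zero_arr C (cosmash C K A) G"
    using assms(1,2) K copairing_zero_iota(1)[of K A "zero_arr C K G" G] by (simp add: K_def in_hom)
  have *: "psi0 C A G \<in> hom C (cosmash C K A) K" "iota C A G \<cdot> psi0 C A G = ?u"
    using kernel_THE[OF is_kernel_iota[OF assms(1,2)], of ?u "cosmash C K A" "psi0 C A G"]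
      sum_to_prod_zeroI[OF assms(1,2) u 1 2] u assms(1,2) c2
    by (simp_all add: psi0_def K_def)
  show "psi0 C A G \<in> hom C (cosmash C K A) K" by fact
  have "k_arr C A G \<cdot> copairing C (j_arr C A G) (eta C A G) = copairing C (iota C A G) (inj1 C A G)"
    using assms(1,2) by (simp add: Comp_copairing)
  note k_copairing = reassoc[OF this, of "iota C K A"]
  show "j_arr C A G \<cdot> psi0 C A G = copairing C (j_arr C A G) (eta C A G) \<cdot> iota C K A"
    by (rule k_arr_mono[OF assms(1,2), of _ _ "cosmash C K A"])
      (use * k_copairing assms(1,2) K in \<open>simp_all add: in_hom K_def\<close>)
qed

lemma conj_T_hom:
  assumes "A \<in> Obj C" "G \<in> Obj C"
  defines "T \<equiv> T_obj C A G"
  shows "conj_T C A G \<in> hom C (cosmash C T G) T"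
    "k_arr C A G \<cdot> conj_T C A G = copairing C (k_arr C A G) (inj2 C A G) \<cdot> iota C T G"
proof -
  let ?u = "copairing C (k_arr C A G) (inj2 C A G) \<cdot> iota C T G"
  have T: "T \<in> Obj C" using assms by simp
  have c2: "c2 C (coprod_obj C A G) \<cdot> cosmash_map C (k_arr C A G) (inj2 C A G) = ?u"
    using assms by (intro c2_cosmash_map) (simp_all add: in_hom)
  have u: "?u \<in> hom C (cosmash C T G) (coprod_obj C A G)"
    using assms(1,2) T by (simp add: in_hom T_def)
  have "r_arr C A G \<cdot> copairing C (k_arr C A G) (inj2 C A G) = r_arr C T G"
    using assms(1,2) by (simp add: Comp_copairing r_arr_def[of C "T_obj C A G"] T_def)
  from reassoc[OF this, of "iota C T G"]
  have "r_arr C A G \<cdot> ?u = zero_arr C (cosmash C T G) G"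
    using assms(1,2) T by (simp add: T_def)
  then show "conj_T C A G \<in> hom C (cosmash C T G) T" "k_arr C A G \<cdot> conj_T C A G = ?u"
    using kernel_THE[OF is_kernel_k_arr[OF assms(1,2)], of ?u "cosmash C T G" "conj_T C A G"]
      u assms(1,2) c2
    by (simp_all add: conj_T_def T_def)
qed

section \<open>Extensions and actions\<close>

context
  fixes A G \<psi>
  assumes AG: "A \<in> Obj C" "G \<in> Obj C" and \<psi>: "\<psi> \<in> hom C (cosmash C A G) A"
begin

lemma psi_simps [simp]: "\<psi> \<in> Arr C" "Dom C \<psi> = cosmash C A G" "Cod C \<psi> = A"
  using \<psi> by (simp_all add: in_hom)

lemma extension_simps:
  assumes "is_extension C A G \<psi> \<xi>"
  shows "\<xi> \<in> Arr C" "Dom C \<xi> = T_obj C A G" "Cod C \<xi> = A" "\<xi> \<cdot> j_arr C A G = \<psi>" "\<xi> \<cdot> eta C A G = idt C A"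
  using assms by (simp_all add: is_extension_def in_hom)

lemma extension_unique:
  assumes "is_extension C A G \<psi> \<xi>" "is_extension C A G \<psi> \<xi>'"
  shows "\<xi> = \<xi>'"
  by (rule T_ext[OF AG, of _ A]) (use assms in \<open>simp_all add: is_extension_def\<close>)

text \<open>An extension is a map out of the point \<open>TA\<close> with prescribed restrictions
  \<psi> to the kernel and identity to the section. The equation is the compatibility condition of
  \<open>semidirect_desc\<close> for this pair; it is necessary, as composing
  \<open>j \<psi>\<^sub>0 = [j, \<eta>] \<iota>\<close> with \<xi> shows.\<close>

lemma extension_iff:
  "(\<exists>\<xi>. is_extension C A G \<psi> \<xi>) \<longleftrightarrow> \<psi> \<cdot> psi0 C A G = c2 C A \<cdot> cosmash_map C \<psi> (idt C A)"
proof -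
  let ?K = "cosmash C A G"
  have c2: "c2 C A \<cdot> cosmash_map C \<psi> (idt C A) = copairing C \<psi> (idt C A) \<cdot> iota C ?K A"
    by (intro c2_cosmash_map) (use AG in \<open>simp_all add: in_hom\<close>)
  note p0 = psi0_hom[OF AG]
  have p0': "psi0 C A G \<in> Arr C" "Dom C (psi0 C A G) = cosmash C ?K A" "Cod C (psi0 C A G) = ?K"
    using p0(1) by (simp_all add: in_hom)
  show ?thesis
  proof
    assume "\<exists>\<xi>. is_extension C A G \<psi> \<xi>"
    then obtain \<xi> where \<xi>: "is_extension C A G \<psi> \<xi>" ..
    note X = extension_simps[OF \<xi>]
    have "\<psi> \<cdot> psi0 C A G = \<xi> \<cdot> (j_arr C A G \<cdot> psi0 C A G)"
      using reassoc[OF X(4), of "psi0 C A G"] X(1-3) AG p0' by simp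
    moreover have "\<xi> \<cdot> copairing C (j_arr C A G) (eta C A G) = copairing C \<psi> (idt C A)"
      using X AG by (simp add: Comp_copairing)
    ultimately show "\<psi> \<cdot> psi0 C A G = c2 C A \<cdot> cosmash_map C \<psi> (idt C A)"
      using c2 p0(2) reassoc[of \<xi> "copairing C (j_arr C A G) (eta C A G)" _ "iota C ?K A"] X(1-3) AG by simp
  next
    assume "\<psi> \<cdot> psi0 C A G = c2 C A \<cdot> cosmash_map C \<psi> (idt C A)"
    then have "\<psi> \<cdot> psi0 C A G = copairing C \<psi> (idt C A) \<cdot> iota C ?K A" using c2 by simp
    then obtain \<xi> where "\<xi> \<in> hom C (T_obj C A G) A" "\<xi> \<cdot> j_arr C A G = \<psi>" "\<xi> \<cdot> eta C A G = idt C A"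
      using semidirect_desc[OF T_point[OF AG], of ?K "psi0 C A G" \<psi> A "idt C A"] p0 \<psi> AG
      by (auto simp: idt_hom)
    then show "\<exists>\<xi>. is_extension C A G \<psi> \<xi>" unfolding is_extension_def by blast
  qed
qed

context
  fixes q
  defines "q \<equiv> coequalizer C (iota C A G) (inj1 C A G \<cdot> \<psi>)"
begin

lemma q_coequalizer: "is_coequalizer C (iota C A G) (inj1 C A G \<cdot> \<psi>) q"
  unfolding q_def using AG
  by (intro coequalizer_ex[of _ "cosmash C A G" "coprod_obj C A G"]) (simp_all add: in_hom)

lemma q_simps:
  "q \<in> Arr C" "Dom C q = coprod_obj C A G" "q \<cdot> iota C A G = q \<cdot> (inj1 C A G \<cdot> \<psi>)"
  using is_coequalizerD[OF q_coequalizer] AG by simp_all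

lemma is_action_iff: "is_action C A G \<psi> \<longleftrightarrow> is_mono C (q \<cdot> inj1 C A G)"
  using \<psi> by (simp add: is_action_def q_def)

text \<open>After composition with \<open>q i_A\<close> both sides of the square equal
  \<open>q [k, i_G] \<iota>\<close>: \<open>q\<close> does not distinguish \<open>k\<close> from
  \<open>i_A \<xi>\<close>, nor \<iota> from \<open>i_A \<psi>\<close>.\<close>

lemma action_imp_commutes:
  assumes \<xi>: "is_extension C A G \<psi> \<xi>" and mono: "is_mono C (q \<cdot> inj1 C A G)"
  shows "\<xi> \<cdot> conj_T C A G = \<psi> \<cdot> cosmash_map C \<xi> (idt C G)"
proof -
  let ?T = "T_obj C A G" and ?k = "k_arr C A G" and ?i1 = "inj1 C A G" and ?i2 = "inj2 C A G"
  note X = extension_simps[OF \<xi>] and c = conj_T_hom[OF AG]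
  have c': "conj_T C A G \<in> Arr C" "Dom C (conj_T C A G) = cosmash C ?T G" "Cod C (conj_T C A G) = ?T"
    using c(1) by (simp_all add: in_hom)
  \<comment> \<open>Along \<open>j_arr\<close> this is the coequalizer equation for
    \<open>q\<close>, and along \<open>eta\<close> both sides are \<open>q i_A\<close>.\<close>
  have qk: "q \<cdot> ?k = q \<cdot> (?i1 \<cdot> \<xi>)"
    by (rule T_ext[OF AG, of _ "Cod C q"]) (use q_simps X AG in \<open>simp_all add: in_hom\<close>)
  have "q \<cdot> (?i1 \<cdot> (\<xi> \<cdot> conj_T C A G)) = q \<cdot> (?k \<cdot> conj_T C A G)"
    using reassoc[OF qk, of "conj_T C A G"] q_simps(1,2) X(1-3) AG c' by simp
  also have "\<dots> = (q \<cdot> copairing C ?k ?i2) \<cdot> iota C ?T G"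
    using q_simps(1,2) AG by (simp add: c(2))
  also have "q \<cdot> copairing C ?k ?i2 = copairing C ((q \<cdot> ?i1) \<cdot> \<xi>) ((q \<cdot> ?i2) \<cdot> idt C G)"
    using q_simps(1,2) AG X(1-3) qk by (simp add: Comp_copairing)
  also have "\<dots> \<cdot> iota C ?T G = copairing C (q \<cdot> ?i1) (q \<cdot> ?i2) \<cdot> (iota C A G \<cdot> cosmash_map C \<xi> (idt C G))"
    using q_simps(1,2) AG X(1-3)
    by (intro copairing_cosmash_map[symmetric]) (simp_all add: in_hom)
  also have "copairing C (q \<cdot> ?i1) (q \<cdot> ?i2) = q"
    by (rule coprod_ext[of _ A G]) (use q_simps(1,2) AG in simp_all)
  also have "q \<cdot> (iota C A G \<cdot> cosmash_map C \<xi> (idt C G)) = q \<cdot> (?i1 \<cdot> (\<psi> \<cdot> cosmash_map C \<xi> (idt C G)))"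
    using reassoc[OF q_simps(3), of "cosmash_map C \<xi> (idt C G)"] q_simps(1,2) AG X(1-3) by simp
  finally have "(q \<cdot> ?i1) \<cdot> (\<xi> \<cdot> conj_T C A G) = (q \<cdot> ?i1) \<cdot> (\<psi> \<cdot> cosmash_map C \<xi> (idt C G))"
    using q_simps(1,2) AG X(1-3) c' by simp
  then show ?thesis
    by (rule monoD[OF mono]) (use q_simps(1,2) AG X(1-3) c' in simp_all)
qed

text \<open>The reflexive graph \<open>[k, i\<^sub>G], \<xi> + 1 : TA + G \<rightarrow> A + G\<close> is coequalized by a map through \<open>q\<close>
  whose kernel pair is its image; commutativity of the diagram is the associativity law
  \<open>\<xi> \<mu> = \<xi> T(\<xi>)\<close> of a \<open>T\<close>-algebra, which separates elements of \<open>A\<close> identified by \<open>q i\<^sub>A\<close>.\<close>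

lemma commutes_imp_action:
  assumes \<xi>: "is_extension C A G \<psi> \<xi>"
    and comm: "\<xi> \<cdot> conj_T C A G = \<psi> \<cdot> cosmash_map C \<xi> (idt C G)"
  shows "is_mono C (q \<cdot> inj1 C A G)"
proof -
  define T k i1 i2 where "T = T_obj C A G" and "k = k_arr C A G" and "i1 = inj1 C A G" and "i2 = inj2 C A G"
  define k' i1' where "k' = k_arr C T G" and "i1' = inj1 C T G"
  define d0 d1 where "d0 = copairing C k i2" and "d1 = coprod_map C \<xi> (idt C G)"
  note X = extension_simps[OF \<xi>] and c = conj_T_hom[OF AG]
  have T: "T \<in> Obj C" using AG by (simp add: T_def)
  have ar: "k \<in> Arr C" "Dom C k = T" "Cod C k = coprod_obj C A G"
    "i1 \<in> Arr C" "Dom C i1 = A" "Cod C i1 = coprod_obj C A G"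
    "i2 \<in> Arr C" "Dom C i2 = G" "Cod C i2 = coprod_obj C A G"
    "k' \<in> Arr C" "Dom C k' = T_obj C T G" "Cod C k' = coprod_obj C T G"
    "i1' \<in> Arr C" "Dom C i1' = T" "Cod C i1' = coprod_obj C T G"
    "\<xi> \<in> Arr C" "Dom C \<xi> = T" "Cod C \<xi> = A"
    "d0 \<in> Arr C" "Dom C d0 = coprod_obj C T G" "Cod C d0 = coprod_obj C A G"
    "d1 \<in> Arr C" "Dom C d1 = coprod_obj C T G" "Cod C d1 = coprod_obj C A G"
    using AG T X(1-3) by (simp_all add: T_def k_def i1_def i2_def k'_def i1'_def d0_def d1_def)
  have d0i: "d0 \<cdot> i1' = k" and d1i: "d1 \<cdot> i1' = i1 \<cdot> \<xi>"
    using AG T ar by (simp_all add: d0_def d1_def i1'_def i1_def k_def i2_def T_def)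
  have rd0: "r_arr C A G \<cdot> d0 = r_arr C T G"
    using AG T by (simp add: d0_def k_def i2_def T_def Comp_copairing r_arr_def[of C "T_obj C A G"])
  have rd1: "r_arr C A G \<cdot> d1 = r_arr C T G"
    using AG T ar by (simp add: d1_def r_arr_def copairing_coprod_map)
  \<comment> \<open>Adding \<open>G\<close> to the unit gives a common section of both legs, since
    \<open>k \<eta> = i_A\<close> and \<open>\<xi> \<eta> = 1\<close>.\<close>
  define s where "s = coprod_map C (eta C A G) (idt C G)"
  have s: "s \<in> hom C (coprod_obj C A G) (coprod_obj C T G)"
    using AG by (simp add: s_def in_hom T_def)
  have "d0 \<cdot> s = copairing C i1 i2"
    using AG by (simp add: d0_def s_def copairing_coprod_map k_def i1_def i2_def)
  also have "\<dots> = idt C (coprod_obj C A G)"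
    by (rule coprod_ext[of _ A G]) (use AG in \<open>simp_all add: i1_def i2_def\<close>)
  finally have d0s: "d0 \<cdot> s = idt C (coprod_obj C A G)" .
  have d1s: "d1 \<cdot> s = idt C (coprod_obj C A G)"
    by (rule coprod_ext[of _ A G])
      (use AG X reassoc[OF X(5)] in \<open>simp_all add: d1_def s_def coprod_map_def Comp_copairing\<close>)
  have dh: "d0 \<in> hom C (coprod_obj C T G) (coprod_obj C A G)" "d1 \<in> hom C (coprod_obj C T G) (coprod_obj C A G)"
    using ar by (simp_all add: in_hom)
  obtain f where f: "f \<in> Arr C" "Dom C f = coprod_obj C A G" "f \<cdot> d0 = f \<cdot> d1"
    and cov: "\<And>W u v. \<lbrakk>u \<in> hom C W (coprod_obj C A G); v \<in> hom C W (coprod_obj C A G); f \<cdot> u = f \<cdot> v\<rbrakk> \<Longrightarrow>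
      \<exists>c n. is_regular_epi C c \<and> c \<in> Arr C \<and> Cod C c = W \<and> n \<in> hom C (Dom C c) (coprod_obj C T G) \<and>
        d0 \<cdot> n = u \<cdot> c \<and> d1 \<cdot> n = v \<cdot> c"
    by (rule reflexive_graph_kernel_pair[OF dh s d0s d1s]) (rule that)
  \<comment> \<open>Restricted to the summand \<open>TA\<close> and then along \<open>j_arr\<close>,
    the equation \<open>f d0 = f d1\<close> becomes the one that defines \<open>q\<close>. Hence
    \<open>f\<close> factors through \<open>q\<close>, and whatever \<open>q\<close> identifies is
    identified by \<open>f\<close>.\<close>
  have "f \<cdot> k = f \<cdot> (i1 \<cdot> \<xi>)"
    using reassoc[OF f(3), of i1'] f(1,2) ar d0i d1i by simp
  from reassoc[OF this, of "j_arr C A G"] have "f \<cdot> iota C A G = f \<cdot> (i1 \<cdot> \<psi>)"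
    using f(1,2) ar AG X(4) by (simp add: k_def T_def)
  then obtain v where v: "v \<in> Arr C" "Dom C v = Cod C q" "v \<cdot> q = f"
    using coequalizer_desc[OF q_coequalizer f(1)] f(2) q_simps(2) by (auto simp: i1_def)

  \<comment> \<open>Both legs commute with the retractions to \<open>G\<close> and so restrict to
    maps \<open>T(TA) \<rightarrow> TA\<close> between their kernels: \<mu> is the multiplication of
    the monad, \<theta> is \<open>T(\<xi>)\<close>.\<close>
  have rk': "r_arr C T G \<cdot> k' = zero_arr C (T_obj C T G) G" using AG T by (simp add: k'_def)
  obtain \<mu> where "\<mu> \<in> hom C (T_obj C T G) T" and k\<mu>: "k \<cdot> \<mu> = d0 \<cdot> k'"
    using k_arr_lift[OF AG, of "d0 \<cdot> k'" "T_obj C T G"] reassoc[OF rd0, of k'] rk' ar AG T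
    by (auto simp: in_hom T_def k_def)
  then have \<mu>: "\<mu> \<in> Arr C" "Dom C \<mu> = T_obj C T G" "Cod C \<mu> = T" by (simp_all add: in_hom)
  obtain \<theta> where "\<theta> \<in> hom C (T_obj C T G) T" and k\<theta>: "k \<cdot> \<theta> = d1 \<cdot> k'"
    using k_arr_lift[OF AG, of "d1 \<cdot> k'" "T_obj C T G"] reassoc[OF rd1, of k'] rk' ar AG T
    by (auto simp: in_hom T_def k_def)
  then have \<theta>: "\<theta> \<in> Arr C" "Dom C \<theta> = T_obj C T G" "Cod C \<theta> = T" by (simp_all add: in_hom)
  have c': "conj_T C A G \<in> Arr C" "Dom C (conj_T C A G) = cosmash C T G" "Cod C (conj_T C A G) = T"
    using c(1) by (simp_all add: in_hom T_def)
  have kcancel: "u = v" if "k \<cdot> u = k \<cdot> v" "u \<in> hom C W T" "v \<in> hom C W T" for u v W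
    using k_arr_mono[OF AG, of u v W] that by (simp add: k_def T_def)
  let ?cm = "cosmash_map C \<xi> (idt C G)"
  have cm: "?cm \<in> Arr C" "Dom C ?cm = cosmash C T G" "Cod C ?cm = cosmash C A G"
    using ar AG by simp_all
  have \<mu>j: "\<mu> \<cdot> j_arr C T G = conj_T C A G"
    by (rule kcancel[of _ _ "cosmash C T G"])
      (use reassoc[OF k\<mu>, of "j_arr C T G"] c(2) c' \<mu> ar AG T in \<open>simp_all add: in_hom k'_def d0_def k_def i2_def T_def\<close>)
  have \<mu>\<eta>: "\<mu> \<cdot> eta C T G = idt C T"
    by (rule kcancel[of _ _ T])
      (use reassoc[OF k\<mu>, of "eta C T G"] d0i \<mu> ar AG T in \<open>simp_all add: in_hom k'_def i1'_def\<close>)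
  have \<theta>j: "\<theta> \<cdot> j_arr C T G = j_arr C A G \<cdot> ?cm"
    by (rule kcancel[of _ _ "cosmash C T G"])
      (use reassoc[OF k\<theta>, of "j_arr C T G"] cosmash_map_hom(2)[of \<xi> "idt C G"] cm \<theta> ar AG T
        in \<open>simp_all add: in_hom k'_def d1_def k_def T_def\<close>)
  have \<theta>\<eta>: "\<theta> \<cdot> eta C T G = eta C A G \<cdot> \<xi>"
    by (rule kcancel[of _ _ T])
      (use reassoc[OF k\<theta>, of "eta C T G"] d1i \<theta> ar AG T in \<open>simp_all add: in_hom k'_def i1'_def k_def i1_def T_def\<close>)
  have \<xi>j: "\<xi> \<cdot> (j_arr C A G \<cdot> ?cm) = \<psi> \<cdot> ?cm" and \<xi>\<eta>: "\<xi> \<cdot> (eta C A G \<cdot> \<xi>) = \<xi>"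
    using reassoc[OF X(4), of ?cm] reassoc[OF X(5), of \<xi>] cm ar AG by (simp_all add: T_def)
  \<comment> \<open>Tested on the point \<open>T(TA)\<close>: along its kernel this is the commuting
    square, and along its section both sides are \<xi>.\<close>
  have alg: "\<xi> \<cdot> \<mu> = \<xi> \<cdot> \<theta>"
  proof (rule T_ext[OF T AG(2), of _ A])
    show "(\<xi> \<cdot> \<mu>) \<cdot> j_arr C T G = (\<xi> \<cdot> \<theta>) \<cdot> j_arr C T G"
      using \<mu> \<theta> ar T AG comm by (simp add: \<mu>j \<theta>j \<xi>j)
    show "(\<xi> \<cdot> \<mu>) \<cdot> eta C T G = (\<xi> \<cdot> \<theta>) \<cdot> eta C T G"
      using \<mu> \<theta> ar T AG by (simp add: \<mu>\<eta> \<theta>\<eta> \<xi>\<eta>)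
  qed (use \<mu> \<theta> ar in \<open>simp_all add: in_hom\<close>)

  show ?thesis
  proof (rule monoI)
    fix x y assume xy: "x \<in> Arr C" "y \<in> Arr C" "Dom C x = Dom C y" "Cod C x = Dom C (q \<cdot> inj1 C A G)"
      "Cod C y = Dom C (q \<cdot> inj1 C A G)" "(q \<cdot> inj1 C A G) \<cdot> x = (q \<cdot> inj1 C A G) \<cdot> y"
    have C: "Cod C x = A" "Cod C y = A" using xy q_simps(1,2) AG by simp_all
    have "v \<cdot> (q \<cdot> (i1 \<cdot> x)) = v \<cdot> (q \<cdot> (i1 \<cdot> y))"
      using xy(1-3,6) C q_simps(1,2) AG by (simp add: i1_def)
    then have "f \<cdot> (i1 \<cdot> x) = f \<cdot> (i1 \<cdot> y)"
      using reassoc[OF v(3), of "i1 \<cdot> x"] reassoc[OF v(3), of "i1 \<cdot> y"] xy(1-3) C v(1,2) q_simps(1,2) ar by simp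
    then obtain c n where cn: "is_regular_epi C c" "c \<in> Arr C" "Cod C c = Dom C x"
      "n \<in> hom C (Dom C c) (coprod_obj C T G)" "d0 \<cdot> n = (i1 \<cdot> x) \<cdot> c" "d1 \<cdot> n = (i1 \<cdot> y) \<cdot> c"
      using cov[of "i1 \<cdot> x" "Dom C x" "i1 \<cdot> y"] xy(1-3) C ar by (auto simp: in_hom)
    have n: "n \<in> Arr C" "Dom C n = Dom C c" "Cod C n = coprod_obj C T G"
      using cn(4) by (simp_all add: in_hom)
    \<comment> \<open>The witness \<open>n\<close> lies over zero in \<open>G\<close> because
      \<open>d0 n\<close> factors through \<open>i_A\<close>. It thus comes from
      \<open>T(TA)\<close>, where the algebra law can be applied.\<close>
    have "r_arr C T G \<cdot> n = r_arr C A G \<cdot> (d0 \<cdot> n)"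
      using reassoc[OF rd0, of n] n ar AG by simp
    also have "\<dots> = zero_arr C (Dom C c) G"
      using cn xy(1-3) C ar AG reassoc[OF r_arr_simps(4)[OF AG], of "x \<cdot> c"] by (simp add: i1_def)
    finally obtain n' where "n' \<in> hom C (Dom C c) (T_obj C T G)" and kn: "k' \<cdot> n' = n"
      using k_arr_lift[OF T AG(2) cn(4)] by (auto simp: k'_def)
    then have n': "n' \<in> Arr C" "Dom C n' = Dom C c" "Cod C n' = T_obj C T G" by (simp_all add: in_hom)
    \<comment> \<open>On the witness \<mu> returns \<open>x\<close> and \<open>T(\<xi>)\<close>
      returns \<open>y\<close>, both embedded by \<open>eta\<close> and restricted to the cover.
      Applying \<xi> removes \<open>eta\<close>, and the algebra law equates the two.\<close>
    have "\<mu> \<cdot> n' = eta C A G \<cdot> (x \<cdot> c)"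
      by (rule kcancel[of _ _ "Dom C c"])
        (use reassoc[OF k\<mu>, of n'] kn cn n' xy(1-3) C \<mu> ar AG in \<open>simp_all add: in_hom k_def i1_def T_def\<close>)
    moreover have "\<theta> \<cdot> n' = eta C A G \<cdot> (y \<cdot> c)"
      by (rule kcancel[of _ _ "Dom C c"])
        (use reassoc[OF k\<theta>, of n'] kn cn n' xy(1-3) C \<theta> ar AG in \<open>simp_all add: in_hom k_def i1_def T_def\<close>)
    ultimately have "\<xi> \<cdot> (eta C A G \<cdot> (x \<cdot> c)) = \<xi> \<cdot> (eta C A G \<cdot> (y \<cdot> c))"
      using reassoc[OF alg, of n'] \<mu> \<theta> n' ar by simp
    then have "x \<cdot> c = y \<cdot> c"
      using reassoc[OF X(5), of "x \<cdot> c"] reassoc[OF X(5), of "y \<cdot> c"] cn(2,3) xy(1-3) C ar AG by (simp add: T_def)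
    then show "x = y"
      by (rule regular_epi_cancel[OF cn(1)]) (use cn(2,3) xy(1-3) C in simp_all)
  qed (use q_simps(1,2) AG in simp)
qed

end

end

end

theorem proposition30:
  fixes C :: "('o, 'm) cat" and A G :: 'o and \<psi> :: 'm
  assumes "semi_abelian C"
    and "A \<in> Obj C" and "G \<in> Obj C"
    and "\<psi> \<in> hom C (cosmash C A G) A"
  shows "((\<exists>\<xi>. is_extension C A G \<psi> \<xi>) \<longleftrightarrow>
            \<psi> \<cdot>\<^bsub>C\<^esub> psi0 C A G = c2 C A \<cdot>\<^bsub>C\<^esub> cosmash_map C \<psi> (idt C A)) \<and>
         (\<forall>\<xi> \<xi>'. is_extension C A G \<psi> \<xi> \<and> is_extension C A G \<psi> \<xi>' \<longrightarrow> \<xi> = \<xi>') \<and>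
         (\<forall>\<xi>. is_extension C A G \<psi> \<xi> \<longrightarrow>
            (is_action C A G \<psi> \<longleftrightarrow>
               \<xi> \<cdot>\<^bsub>C\<^esub> conj_T C A G = \<psi> \<cdot>\<^bsub>C\<^esub> cosmash_map C \<xi> (idt C G)))"
proof -
  interpret semi_abelian C by fact
  note hyps = assms(2-4)
  show ?thesis
    using extension_iff[OF hyps] extension_unique[OF hyps] is_action_iff[OF hyps]
      action_imp_commutes[OF hyps] commutes_imp_action[OF hyps]
    by blast
qed

end
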